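(* The fourth-order piecewise linear ordinary differential equation $$\varphi^{(4)}(s) + 10\,\varphi'''(s) + 35\,\varphi''(s) + 50\,\varphi'(s) + 24\,\varphi(s) + \operatorname{sign}(\varphi(s)) = 0$$ for a real-valued function $\varphi$ of a real variable $s$ has a nontrivial asymptotically stable periodic solution.
   Context: The equation is viewed as a discontinuous (piecewise smooth) dynamical system in $\mathbb{R}^4$ through $x=(x_1,x_2,x_3,x_4)=(\varphi,\varphi',\varphi'',\varphi''')$. It reads $\dot x_1=x_2$, $\dot x_2=x_3$, $\dot x_3=x_4$, $\dot x_4=-24x_1-50x_2-35x_3-10x_4-\operatorname{sign}(x_1)$, with switching manifold $\{x\in\mathbb{R}^4: x_1=0\}$. Here $\operatorname{sign}(u)=1$ for $u>0$ and $\operatorname{sign}(u)=-1$ for $u<0$. Solutions are understood in the usual (Filippov) sense for discontinuous systems: a solution on an interval $J$ is a function $\varphi\in C^3(J)$ with $\varphi'''$ locally absolutely continuous such that, for almost every $s\in J$, $$-\bigl(\varphi^{(4)}(s)+10\varphi'''(s)+35\varphi''(s)+50\varphi'(s)+24\varphi(s)\bigr)\in \operatorname{Sgn}(\varphi(s)),$$ where $\operatorname{Sgn}(u)=\{\operatorname{sign}(u)\}$ for $u\neq 0$ and $\operatorname{Sgn}(0)=[-1,1]$. A periodic solution is a solution $\varphi$ on $\mathbb{R}$ for which there is $T>0$ with $\varphi(s+T)=\varphi(s)$ for all $s$. It is nontrivial if it is not identically zero. Asymptotic stability of a periodic solution $\varphi$ means asymptotic stability of its orbit $\mathcal{O}=\{(\varphi(s),\varphi'(s),\varphi''(s),\varphi'''(s)):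 s\in\mathbb{R}\}\subset\mathbb{R}^4$, that is, both of the following: (i) for every $\varepsilon>0$ there is $\delta>0$ such that every solution $\psi$ on $[0,\infty)$ whose state $x_\psi(s)=(\psi(s),\psi'(s),\psi''(s),\psi'''(s))$ satisfies $\operatorname{dist}(x_\psi(0),\mathcal{O})<\delta$ satisfies $\operatorname{dist}(x_\psi(s),\mathcal{O})<\varepsilon$ for all $s\ge 0$; (ii) there is $\eta>0$ such that every solution $\psi$ on $[0,\infty)$ with $\operatorname{dist}(x_\psi(0),\mathcal{O})<\eta$ satisfies $\operatorname{dist}(x_\psi(s),\mathcal{O})\to 0$ as $s\to\infty$. *)

theory Defs
  imports "HOL-Analysis.Analysis"
begin

text \<open>
  Throughout, \<open>J\<close> is a nondegenerate interval of reals (below: \<open>UNIV\<close> or \<open>{0..}\<close>). All derivatives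
  are taken within \<open>J\<close>, hence are one-sided at an endpoint of \<open>J\<close>, and the values of a function
  outside \<open>J\<close> are irrelevant.
\<close>

definition nth_deriv_on :: "real set \<Rightarrow> nat \<Rightarrow> (real \<Rightarrow> real) \<Rightarrow> real \<Rightarrow> real" where
  "nth_deriv_on J k f = ((\<lambda>g s. vector_derivative g (at s within J)) ^^ k) f"

definition C_k_on :: "nat \<Rightarrow> (real \<Rightarrow> real) \<Rightarrow> real set \<Rightarrow> bool" where
  "C_k_on k f J \<longleftrightarrow>
     (\<forall>j<k. nth_deriv_on J j f differentiable_on J) \<and> continuous_on J (nth_deriv_on J k f)"

text \<open>
  A division is a finite family of compact intervals \<open>K = {Inf K..Sup K}\<close> with pairwise disjoint
  interiors; \<open>S\<close> is just the union of that family. (The constant \<open>absolutely_continuous\<close> of the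
  library concerns measures.)
\<close>

definition abs_continuous_on :: "real set \<Rightarrow> (real \<Rightarrow> real) \<Rightarrow> bool" where
  "abs_continuous_on I f \<longleftrightarrow>
     (\<forall>\<epsilon>>0. \<exists>\<delta>>0. \<forall>\<D> S. \<D> division_of S \<and> S \<subseteq> I \<and> (\<Sum>K\<in>\<D>. Sup K - Inf K) < \<delta> \<longrightarrow>
        (\<Sum>K\<in>\<D>. \<bar>f (Sup K) - f (Inf K)\<bar>) < \<epsilon>)"

definition locally_abs_continuous_on :: "real set \<Rightarrow> (real \<Rightarrow> real) \<Rightarrow> bool" where
  "locally_abs_continuous_on J f \<longleftrightarrow> (\<forall>a b. {a..b} \<subseteq> J \<longrightarrow> abs_continuous_on {a..b} f)"

definition Sgn :: "real \<Rightarrow> real set" where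
  "Sgn u = (if u = 0 then {-1..1} else {sgn u})"

text \<open>
  The fourth derivative only exists almost everywhere, and \<^const>\<open>vector_derivative\<close> is total, so its
  existence is part of the almost-everywhere condition.
\<close>

definition filippov_solution_on :: "real set \<Rightarrow> (real \<Rightarrow> real) \<Rightarrow> bool" where
  "filippov_solution_on J \<phi> \<longleftrightarrow>
     C_k_on 3 \<phi> J \<and>
     locally_abs_continuous_on J (nth_deriv_on J 3 \<phi>) \<and>
     (AE s in lebesgue. s \<in> J \<longrightarrow>
        nth_deriv_on J 3 \<phi> differentiable (at s within J) \<and>
        - (nth_deriv_on J 4 \<phi> s + 10 * nth_deriv_on J 3 \<phi> s + 35 * nth_deriv_on J 2 \<phi> s
             + 50 * nth_deriv_on J 1 \<phi> s + 24 * \<phi> s) \<in> Sgn (\<phi> s))"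

definition state_on :: "real set \<Rightarrow> (real \<Rightarrow> real) \<Rightarrow> real \<Rightarrow> real ^ 4" where
  "state_on J \<phi> s =
     vector [\<phi> s, nth_deriv_on J 1 \<phi> s, nth_deriv_on J 2 \<phi> s, nth_deriv_on J 3 \<phi> s]"

definition periodic_solution :: "(real \<Rightarrow> real) \<Rightarrow> bool" where
  "periodic_solution \<phi> \<longleftrightarrow>
     filippov_solution_on UNIV \<phi> \<and> (\<exists>T>0. \<forall>s. \<phi> (s + T) = \<phi> s)"

definition nontrivial :: "(real \<Rightarrow> real) \<Rightarrow> bool" where
  "nontrivial \<phi> \<longleftrightarrow> (\<exists>s. \<phi> s \<noteq> 0)"

definition orbit :: "(real \<Rightarrow> real) \<Rightarrow> (real ^ 4) set" where
  "orbit \<phi> = range (state_on UNIV \<phi>)"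

definition asymptotically_stable :: "(real \<Rightarrow> real) \<Rightarrow> bool" where
  "asymptotically_stable \<phi> \<longleftrightarrow>
     (\<forall>\<epsilon>>0. \<exists>\<delta>>0. \<forall>\<psi>. filippov_solution_on {0..} \<psi> \<and>
        infdist (state_on {0..} \<psi> 0) (orbit \<phi>) < \<delta> \<longrightarrow>
        (\<forall>s\<ge>0. infdist (state_on {0..} \<psi> s) (orbit \<phi>) < \<epsilon>)) \<and>
     (\<exists>\<eta>>0. \<forall>\<psi>. filippov_solution_on {0..} \<psi> \<and>
        infdist (state_on {0..} \<psi> 0) (orbit \<phi>) < \<eta> \<longrightarrow>
        ((\<lambda>s. infdist (state_on {0..} \<psi> s) (orbit \<phi>)) \<longlongrightarrow> 0) at_top)"

end

theory Submission
  imports Defs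
begin

text \<open>
  The linear part factors as \<open>(D + 1) (D + 2) (D + 3) (D + 4)\<close>, so partial fractions split a solution
  into four modes with \<open>y\<^sub>k' = - k y\<^sub>k - sign \<phi>\<close>, which are explicit exponentials as long as \<open>\<phi>\<close> keeps
  its sign. A periodic solution that changes sign under translation by a half period is found by
  solving one algebraic equation for \<open>q = exp (- half period)\<close>. It crosses \<open>\<phi> = 0\<close> transversally, so
  every Filippov solution that starts nearby also crosses in well separated, isolated points. The
  half-return map, followed by \<open>x \<mapsto> - x\<close>, maps a neighbourhood of the crossing point in the switching
  manifold to itself and is a contraction; iterating it gives convergence to the orbit.
\<close>

subsection \<open>Absolutely continuous functions\<close>

text \<open>Solving the closing equation for \<open>q\<close> yields only a candidate: the half
  orbit must also have no zero in between. Since \<open>q\<close> is algebraic,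
  \<open>readout 0\<close> along the arc is an explicit quartic in z = exp (- time) divisible by (1
  - z) (z - q), so positivity reduces to a quadratic. The crossing is transversal, but \<phi>' is
  only about 0.022 there, which is why fine rational enclosures are carried along and the admissible
  neighbourhoods are small. The differential inclusion leaves the relay value free where \<phi> = 0,
  so the exponential formulas hold only on intervals already known to be free of zeros; each return
  needs a continuation argument that excludes an early zero. The return map is not linearised. In
  mode coordinates the hit of a perturbed arc and the hit at \<open>q\<close> can be subtracted
  exactly, and the contraction becomes a numerical estimate.\<close>

text \<open>
  Choose a gauge that controls the difference quotient off the null set \<open>N\<close> and keeps the intervals
  tagged in \<open>N\<close> inside an open set of small measure; absolute continuity bounds the contribution of
  the latter.
\<close>

lemma abs_continuous_has_integral_derivative:
  fixes f h :: "real \<Rightarrow> real"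
  assumes ac: "abs_continuous_on {a..b} f" and ab: "a \<le> b" and N: "negligible N"
    and deriv: "\<And>x. x \<in> {a..b} - N \<Longrightarrow> (f has_vector_derivative h x) (at x within {a..b})"
  shows "(h has_integral (f b - f a)) {a..b}"
proof -
  \<comment> \<open>With the integrand set to 0 on \<open>N\<close>, the terms tagged in
    \<open>N\<close> are mere increments of \<open>f\<close>, which is what absolute continuity
    controls.\<close>
  define g where "g x = (if x \<in> N then 0 else h x)" for x
  have "(g has_integral (f b - f a)) (cbox a b)"
    unfolding has_integral
  proof (intro allI impI)
    fix e :: real assume e: "e > 0"
    define e1 where "e1 = e / (2 * (b - a + 1))"
    have e1: "e1 > 0" using e ab by (simp add: e1_def)
    obtain d where d: "d > 0" and dac: "\<And>\<D> S. \<D> division_of S \<Longrightarrow> S \<subseteq> {a..b} \<Longrightarrow>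
        (\<Sum>K\<in>\<D>. Sup K - Inf K) < d \<Longrightarrow> (\<Sum>K\<in>\<D>. \<bar>f (Sup K) - f (Inf K)\<bar>) < e / 2"
      using ac e unfolding abs_continuous_on_def by (meson half_gt_zero)
    have Nl: "N \<in> sets lebesgue" using N negligible_imp_sets by blast
    obtain U where U: "open U" "N \<subseteq> U" "(U - N) \<in> lmeasurable" "emeasure lebesgue (U - N) < ennreal d"
      using sets_lebesgue_outer_open[OF Nl d] by blast
    have Um: "U \<in> lmeasurable"
    proof -
      have "U = (U - N) \<union> N" using U by auto
      then show ?thesis using U(3) negligible_imp_measurable[OF N]
        by (metis fmeasurable.Un)
    qed
    have mU: "measure lebesgue U < d"
    proof -
      have "measure lebesgue U = measure lebesgue (U - N)"
        using N Um by (simp add: measure_Diff_null_set negligible_iff_null_sets fmeasurableD)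
      also have "\<dots> < d"
        using U(3,4) d by (simp add: emeasure_eq_measure2 ennreal_less_iff)
      finally show ?thesis .
    qed
    have "\<exists>r>0. (x \<in> N \<longrightarrow> ball x r \<subseteq> U) \<and>
        (x \<in> {a..b} - N \<longrightarrow> (\<forall>y\<in>{a..b}. \<bar>y - x\<bar> < r \<longrightarrow> \<bar>f y - f x - (y - x) * h x\<bar> \<le> e1 * \<bar>y - x\<bar>))" for x
    proof (cases "x \<in> N")
      case True
      then show ?thesis using U(1,2) open_contains_ball by auto
    next
      case False
      show ?thesis
      proof (cases "x \<in> {a..b}")
        case True
        then have "(f has_derivative (\<lambda>t. t *\<^sub>R h x)) (at x within {a..b})"
          using deriv False by (simp add: has_vector_derivative_def)
        then show ?thesis
          using e1 False by (fastforce simp: has_derivative_within_alt)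
      next
        case F: False
        show ?thesis using False F by (intro exI[of _ 1]) auto
      qed
    qed
    then obtain r where r: "\<And>x. r x > 0"
      and rN: "\<And>x. x \<in> N \<Longrightarrow> ball x (r x) \<subseteq> U"
      and rd: "\<And>x y. x \<in> {a..b} - N \<Longrightarrow> y \<in> {a..b} \<Longrightarrow> \<bar>y - x\<bar> < r x \<Longrightarrow>
          \<bar>f y - f x - (y - x) * h x\<bar> \<le> e1 * \<bar>y - x\<bar>"
      by metis
    define \<gamma> where "\<gamma> x = ball x (r x)" for x
    have gau: "gauge \<gamma>" unfolding \<gamma>_def using r by (intro gauge_ball_dependent) auto
    have small: "norm ((\<Sum>(x,K)\<in>p. measure lborel K *\<^sub>R g x) - (f b - f a)) < e"
      if p: "p tagged_division_of cbox a b" and fine: "\<gamma> fine p" for p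
    proof -
      have finp: "finite p" using p by blast
      have KI: "\<exists>u v. K = {u..v} \<and> u \<le> x \<and> x \<le> v \<and> a \<le> u \<and> v \<le> b \<and> {u..v} \<subseteq> ball x (r x)"
        if xK: "(x, K) \<in> p" for x K
      proof -
        obtain u v where K: "K = cbox u v" using p xK by blast
        have xin: "x \<in> K" using p xK by blast
        have "K \<subseteq> cbox a b" using p xK by blast
        moreover have "K \<subseteq> ball x (r x)" using fine xK unfolding fine_def \<gamma>_def by auto
        ultimately show ?thesis using K xin by (intro exI[of _ u] exI[of _ v]) auto
      qed
      define pN where "pN = {xK \<in> p. fst xK \<in> N}"
      have fb: "(\<Sum>(x,K)\<in>p. f (Sup K) - f (Inf K)) = f b - f a"
        using additive_tagged_division_1[OF ab, of p f] p by simp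
      have pNp: "pN \<subseteq> p" unfolding pN_def by auto
      have tp: "pN tagged_partial_division_of cbox a b"
        by (rule tagged_partial_division_subset[OF _ pNp]) (use p in \<open>simp add: tagged_division_of_def\<close>)
      have tN: "pN tagged_division_of (\<Union>(snd ` pN))"
        using tagged_partial_division_of_Union_self[OF tp] .
      have dN: "snd ` pN division_of \<Union>(snd ` pN)"
        using division_of_tagged_division[OF tN] .
      have subN: "\<Union>(snd ` pN) \<subseteq> {a..b}" using KI pNp by fastforce
      have subU: "\<Union>(snd ` pN) \<subseteq> U"
      proof
        fix t assume "t \<in> \<Union>(snd ` pN)"
        then obtain x K where "(x, K) \<in> pN" "t \<in> K" by auto
        then show "t \<in> U" using KI[of x K] pNp rN[of x] unfolding pN_def by auto
      qed
      have SI: "(\<Sum>K\<in>snd ` pN. Sup K - Inf K) = (\<Sum>K\<in>snd ` pN. measure lebesgue K)"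
      proof (intro sum.cong refl)
        fix K assume "K \<in> snd ` pN"
        then obtain x where "(x, K) \<in> p" using pNp by auto
        then show "Sup K - Inf K = measure lebesgue K" using KI[of x K] by (auto simp: measure_completion)
      qed
      also have "\<dots> = measure lebesgue (\<Union>(snd ` pN))"
        using content_division[OF dN] .
      also have "\<dots> \<le> measure lebesgue U"
        using subU Um dN by (intro measure_mono_fmeasurable)
           (auto intro: lmeasurable_division fmeasurableD)
      also have "\<dots> < d" by (rule mU)
      finally have "(\<Sum>K\<in>snd ` pN. \<bar>f (Sup K) - f (Inf K)\<bar>) < e / 2"
        using dac[OF dN subN] by simp
      moreover have "(\<Sum>(x,K)\<in>pN. \<bar>f (Sup K) - f (Inf K)\<bar>) = (\<Sum>K\<in>snd ` pN. \<bar>f (Sup K) - f (Inf K)\<bar>)"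
      proof -
        \<comment> \<open>Distinct tags may share a degenerate interval, so passing to the set of
          intervals requires a summand that vanishes on boxes with empty interior.
          \<open>Sup\<close> and \<open>Inf\<close> of the empty set are unspecified, hence the
          explicit 0.\<close>
        let ?v = "\<lambda>K. if K = {} then 0 else \<bar>f (Sup K) - f (Inf K)\<bar>"
        have ne: "K \<noteq> {}" if "(x, K) \<in> pN" for x K
          using KI[OF subsetD[OF pNp that]] by fastforce
        have "(\<Sum>(x,K)\<in>pN. \<bar>f (Sup K) - f (Inf K)\<bar>) = (\<Sum>(x,K)\<in>pN. ?v K)"
          using ne by (intro sum.cong) auto
        also have "\<dots> = (\<Sum>K\<in>snd ` pN. ?v K)"
          by (rule sum.over_tagged_division_lemma[OF tN]) auto
        also have "\<dots> = (\<Sum>K\<in>snd ` pN. \<bar>f (Sup K) - f (Inf K)\<bar>)"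
          using ne by (intro sum.cong) auto
        finally show ?thesis .
      qed
      ultimately have sN: "(\<Sum>(x,K)\<in>pN. \<bar>f (Sup K) - f (Inf K)\<bar>) < e / 2" by simp
      define T where "T xK = measure lborel (snd xK) * g (fst xK) - (f (Sup (snd xK)) - f (Inf (snd xK)))" for xK
      have "(\<Sum>(x,K)\<in>p. measure lborel K *\<^sub>R g x) - (f b - f a) = sum T p"
        unfolding fb[symmetric] T_def by (simp only: sum_subtractf[symmetric] real_scaleR_def case_prod_unfold)
      then have "norm ((\<Sum>(x,K)\<in>p. measure lborel K *\<^sub>R g x) - (f b - f a)) \<le> (\<Sum>xK\<in>p. \<bar>T xK\<bar>)"
        by (simp only: real_norm_def sum_abs)
      also have "\<dots> = (\<Sum>xK\<in>p - pN. \<bar>T xK\<bar>) + (\<Sum>xK\<in>pN. \<bar>T xK\<bar>)"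
        by (rule sum.subset_diff[OF pNp finp])
      also have "(\<Sum>xK\<in>pN. \<bar>T xK\<bar>) = (\<Sum>(x,K)\<in>pN. \<bar>f (Sup K) - f (Inf K)\<bar>)"
        by (intro sum.cong) (auto simp: pN_def g_def T_def)
      also have "(\<Sum>xK\<in>p - pN. \<bar>T xK\<bar>) \<le> (\<Sum>(x,K)\<in>p - pN. e1 * measure lborel K)"
      proof (intro sum_mono, clarify)
        fix x K assume xK: "(x, K) \<in> p" "(x, K) \<notin> pN"
        obtain u v where K: "K = {u..v}" "u \<le> x" "x \<le> v" "a \<le> u" "v \<le> b" "{u..v} \<subseteq> ball x (r x)"
          using KI[OF xK(1)] by auto
        have xN: "x \<in> {a..b} - N" using xK K unfolding pN_def by auto
        have "u \<in> ball x (r x)" "v \<in> ball x (r x)"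
          using subsetD[OF K(6), of u] subsetD[OF K(6), of v] K by (simp_all del: mem_ball)
        then have 1: "\<bar>f u - f x - (u - x) * h x\<bar> \<le> e1 * (x - u)"
          and 2: "\<bar>f v - f x - (v - x) * h x\<bar> \<le> e1 * (v - x)"
          using rd[OF xN, of u] rd[OF xN, of v] K by (auto simp: dist_real_def)
        have "measure lborel K * g x - (f (Sup K) - f (Inf K)) =
          (f u - f x - (u - x) * h x) - (f v - f x - (v - x) * h x)"
          using K xN by (simp add: g_def algebra_simps)
        also have "\<bar>\<dots>\<bar> \<le> e1 * (v - u)" using 1 2 by (simp add: algebra_simps)
        finally show "\<bar>T (x, K)\<bar> \<le> e1 * measure lborel K"
          using K by (simp add: T_def)
      qed
      also have "(\<Sum>(x,K)\<in>p - pN. e1 * measure lborel K) \<le> (\<Sum>(x,K)\<in>p. e1 * measure lborel K)"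
        using finp e1 by (intro sum_mono2) auto
      also have "\<dots> = e1 * (b - a)"
      proof -
        have "(\<Sum>(x,K)\<in>p. measure lborel K) = b - a"
          using additive_content_tagged_division[OF p] ab by simp
        then show ?thesis by (simp add: sum_distrib_left[symmetric] case_prod_unfold)
      qed
      also have "\<dots> \<le> e / 2" using e ab by (simp add: e1_def field_simps)
      finally show ?thesis using sN by linarith
    qed
    show "\<exists>\<gamma>. gauge \<gamma> \<and> (\<forall>\<D>. \<D> tagged_division_of cbox a b \<and> \<gamma> fine \<D> \<longrightarrow>
        norm ((\<Sum>(x,K)\<in>\<D>. measure lborel K *\<^sub>R g x) - (f b - f a)) < e)" using gau small by (intro exI[of _ \<gamma>] conjI allI impI) auto
  qed
  then show ?thesis
    using has_integral_spike[OF N, of "{a..b}" h g] by (simp add: g_def)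
qed

lemma abs_continuous_on_subset:
  assumes "abs_continuous_on T f" "S \<subseteq> T"
  shows "abs_continuous_on S f"
  using assms unfolding abs_continuous_on_def by (meson order_trans)

text \<open>The function is the integral of its almost everywhere derivative \<open>h\<close>, and
  continuity of \<open>h\<close> lets the fundamental theorem of calculus apply at every point. This
  turns an almost everywhere condition into an ordinary equation on a closed interval.\<close>

lemma abs_continuous_derivative_ae:
  fixes f h :: "real \<Rightarrow> real"
  assumes ac: "abs_continuous_on {a..b} f" and ab: "a \<le> b" and N: "negligible N"
    and deriv: "\<And>x. x \<in> {a<..<b} - N \<Longrightarrow> (f has_real_derivative h x) (at x)"
    and cont: "continuous_on {a..b} h" and x: "x \<in> {a..b}"
  shows "(f has_real_derivative h x) (at x within {a..b})"
proof -
  have N': "negligible (insert a (insert b N))" using N by simp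
  have int: "(h has_integral (f t - f a)) {a..t}" if t: "t \<in> {a..b}" for t
  proof (rule abs_continuous_has_integral_derivative[OF _ _ N'])
    show "abs_continuous_on {a..t} f" using abs_continuous_on_subset[OF ac] t by auto
    show "a \<le> t" using t by simp
    fix s assume "s \<in> {a..t} - insert a (insert b N)"
    then have "s \<in> {a<..<b} - N" using t by auto
    then show "(f has_vector_derivative h s) (at s within {a..t})"
      using deriv has_real_derivative_iff_has_vector_derivative has_vector_derivative_at_within by blast
  qed
  have "((\<lambda>t. f a + integral {a..t} h) has_vector_derivative h x) (at x within {a..b})"
    using integral_has_vector_derivative[OF cont x] by (auto intro!: derivative_eq_intros)
  moreover have "f a + integral {a..t} h = f t" if "t \<in> {a..b}" for t
    using int[OF that] by (simp add: integral_unique)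
  ultimately have "(f has_vector_derivative h x) (at x within {a..b})"
    using has_vector_derivative_transform[OF x, of f "\<lambda>t. f a + integral {a..t} h"] by metis
  then show ?thesis by (simp add: has_real_derivative_iff_has_vector_derivative)
qed

subsection \<open>The flow between two switchings\<close>

text \<open>
  The coefficients are the residues of \<open>1 / ((x + 1) (x + 2) (x + 3) (x + 4))\<close>: if the modes satisfy
  \<open>y\<^sub>k' = - k y\<^sub>k + w\<close>, then \<open>readout j y\<close> is the \<open>j\<close>-th derivative of \<open>\<phi> = readout 0 y\<close> for \<open>j \<le> 3\<close>.
\<close>

definition readout :: "nat \<Rightarrow> (nat \<Rightarrow> real) \<Rightarrow> real" where
  "readout j y = ((-1)^j * y 1 - 3 * (-2)^j * y 2 + 3 * (-3)^j * y 3 - (-4)^j * y 4) / 6"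

text \<open>
  The half period \<open>T\<close> of the symmetric orbit solves
  \<open>tanh (T/2) - 3/2 tanh T + tanh (3T/2) - 1/4 tanh (2T) = 0\<close>. With \<open>x = tanh\<^sup>2 (T/2)\<close> this reduces to
  \<open>x\<^sup>2 + 5 x = 2\<close>, and \<open>q = exp (- T)\<close> is a root of a palindromic quartic, hence the substitution
  \<open>v = q + 1/q\<close>.
\<close>

definition q :: real where
  "q = (let v = (3 + sqrt 33) / 2 in (v - sqrt (v\<^sup>2 - 4)) / 2)"

text \<open>The half orbit must end at the negative of its start: -1/k + A q^k = -(-1/k + A) has
  this A as its only solution.\<close>

definition amp :: "nat \<Rightarrow> real" where
  "amp k = 2 / (real k * (1 + q ^ k))"

text \<open>
  The solution of \<open>y\<^sub>k' = - k y\<^sub>k - 1\<close> in the variable \<open>z = exp (- time)\<close>, which makes everything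
  polynomial. For \<open>d = 0\<close> and \<open>z\<close> running from \<open>1\<close> to \<open>q\<close> this is the half of the periodic orbit on
  which \<open>\<phi>\<close> is positive; \<open>d\<close> is the initial perturbation.
\<close>

definition relay_arc :: "(nat \<Rightarrow> real) \<Rightarrow> real \<Rightarrow> nat \<Rightarrow> real" where
  "relay_arc d z k = - 1 / real k + (amp k + d k) * z ^ k"

section \<open>Rational enclosures of the constants of the orbit\<close>

lemma readout_0: "readout 0 y = (y 1 - 3 * y 2 + 3 * y 3 - y 4) / 6"
  and readout_1: "readout 1 y = (- y 1 + 6 * y 2 - 9 * y 3 + 4 * y 4) / 6"
  by (simp_all add: readout_def)

text \<open>The roots of x^2 - v x + 1 are \<open>q\<close> and 1/q, and the quartic equals q^2 (v^2
  - 3 v - 6) with v = q + 1/q.\<close>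

lemma q_root: "q^4 - 3 * q^3 - 4 * q\<^sup>2 - 3 * q + 1 = 0"
  and q_bounds: "2421/10000 < q" "q < 1211/5000"
proof -
  define v :: real where "v = (3 + sqrt 33) / 2"
  define w where "w = sqrt (v\<^sup>2 - 4)"
  have s: "11489/2000 < sqrt (33::real)" "sqrt (33::real) < 28723/5000"
    by (rule real_less_rsqrt, simp add: power2_eq_square) (rule real_less_lsqrt, simp_all add: power2_eq_square)
  have v: "v\<^sup>2 = 3 * v + 6" unfolding v_def by (simp add: power2_eq_square field_simps)
  have vb: "17489/4000 < v" "v < 43723/10000" using s by (auto simp: v_def)
  have w2: "w\<^sup>2 = v\<^sup>2 - 4" unfolding w_def using v vb by simp
  have wb: "486/125 < w" "w < 77761/20000" unfolding w_def v
    by (rule real_less_rsqrt, use vb in \<open>simp add: power2_eq_square\<close>,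
        rule real_less_lsqrt, use vb in \<open>simp_all add: power2_eq_square\<close>)
  have q: "q = (v - w) / 2" unfolding q_def v_def w_def by (simp add: Let_def)
  have vq: "q\<^sup>2 = v * q - 1"
    using w2 unfolding q by (simp add: power2_eq_square field_simps)
  show "q^4 - 3 * q^3 - 4 * q\<^sup>2 - 3 * q + 1 = 0" using v vq by algebra
  show "2421/10000 < q" "q < 1211/5000" unfolding q using vb wb by (simp_all)
qed

lemma q_power_bounds:
  "293/5000 < q\<^sup>2" "q\<^sup>2 < 587/10000" "709/50000 < q^3" "q^3 < 1421/100000" "687/200000 < q^4" "q^4 < 1721/500000"
proof -
  have "(2421/10000)^n < q^n" "q^n < (1211/5000)^n" if "n > 0" for n
    using q_bounds that by (auto intro!: power_strict_mono)
  from this[of 2] this[of 3] this[of 4]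
  show "293/5000 < q\<^sup>2" "q\<^sup>2 < 587/10000" "709/50000 < q^3" "q^3 < 1421/100000" "687/200000 < q^4" "q^4 < 1721/500000"
    by (simp_all add: eval_nat_numeral)
qed

lemma amp_bounds:
  "161/100 < amp 1" "amp 1 < 16103/10000" "1889/2000 < amp 2" "amp 2 < 9447/10000"
  "1643/2500 < amp 3" "amp 3 < 3287/5000" "2491/5000 < amp 4" "amp 4 < 4983/10000"
  using q_bounds q_power_bounds by (simp_all add: amp_def field_simps)

section \<open>Closing relations and shape of the unperturbed half orbit\<close>

lemma amp_q: "k > 0 \<Longrightarrow> amp k * q ^ k = 2 / real k - amp k"
proof -
  assume "k > 0"
  moreover have "1 + q ^ k > 0" using q_bounds by (simp add: add_pos_pos)
  ultimately show ?thesis by (simp add: amp_def divide_simps)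
qed

lemma arc_q: "k > 0 \<Longrightarrow> relay_arc (\<lambda>_. 0) q k = - relay_arc (\<lambda>_. 0) 1 k"
  by (simp add: relay_arc_def amp_q field_simps)

text \<open>Inverses of q and 1 + q^k are computed modulo the quartic \<open>m\<close>; the
  multiples of \<open>m\<close> in the proof are the quotients of that division. Identities between
  amplitudes become polynomial identities in \<open>q\<close>.\<close>

lemma amp_polynomials:
  "amp 1 = (3 + 4 * q\<^sup>2 - q^3) / 2" "amp 2 = (5 + 3 * q - q\<^sup>2) / 6"
  "amp 3 = (7 + 3 * q + 3 * q\<^sup>2 - q^3) / 12" "amp 4 = (2 - 3 * q + 13 * q\<^sup>2 - 3 * q^3) / 4"
  "1 / q = 3 + 4 * q + 3 * q\<^sup>2 - q^3"
proof -
  define m where "m = q^4 - 3 * q^3 - 4 * q\<^sup>2 - 3 * q + 1"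
  have m: "m = 0" using q_root by (simp add: m_def)
  have "(3 + 4 * q\<^sup>2 - q^3) * (1 + q) = 4 - m" "(5 + 3 * q - q\<^sup>2) * (2 + 2 * q\<^sup>2) = 12 - 2 * m"
    "(7 + 3 * q + 3 * q\<^sup>2 - q^3) * (3 + 3 * q^3) = 24 - 3 * (1 + q\<^sup>2) * m"
    "(2 - 3 * q + 13 * q\<^sup>2 - 3 * q^3) * (4 + 4 * q^4) = 8 + 4 * (4 * q\<^sup>2 - 3 * q - 3 * q^3) * m"
    "(3 + 4 * q + 3 * q\<^sup>2 - q^3) * q = 1 - m"
    unfolding m_def by algebra+
  then show "amp 1 = (3 + 4 * q\<^sup>2 - q^3) / 2" "amp 2 = (5 + 3 * q - q\<^sup>2) / 6"
    "amp 3 = (7 + 3 * q + 3 * q\<^sup>2 - q^3) / 12" "amp 4 = (2 - 3 * q + 13 * q\<^sup>2 - 3 * q^3) / 4"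
    "1 / q = 3 + 4 * q + 3 * q\<^sup>2 - q^3"
    using q_bounds q_power_bounds unfolding m amp_def by (simp_all add: divide_simps mult.commute)
qed

text \<open>The arc lies on the switching manifold at z = 1 and z = q. The coefficients of z^4, z^3
  and 1 determine the quadratic cofactor; that the remaining two agree is the quartic equation for
  \<open>q\<close>.\<close>

lemma readout_arc_factor:
  "readout 0 (relay_arc (\<lambda>_. 0) z) = (1 - z) * (z - q) *
     (amp 4 / 6 * z\<^sup>2 + ((1 + q) * (amp 4 / 6) - amp 3 / 2) * z + 1 / (24 * q))" (is "?l = ?r")
proof -
  have c: "1 / (24 * q) = (1 / q) / 24" by simp
  have l: "?l = - 1 / 24 + amp 1 / 6 * z - amp 2 / 2 * z\<^sup>2 + amp 3 / 2 * z^3 - amp 4 / 6 * z^4"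
    by (simp add: readout_0 relay_arc_def field_simps)
  have "24 * (?r - ?l) = (q^4 - 3 * q^3 - 4 * q\<^sup>2 - 3 * q + 1) * (1 + (3 * q - 3) * z + (2 - 3 * q) * z\<^sup>2)"
    unfolding l c amp_polynomials by (simp add: field_simps power2_eq_square power3_eq_cube power4_eq_xxxx)
  then show ?thesis unfolding q_root by simp
qed

text \<open>The expression is \<phi>' / z on the unperturbed arc, that is, minus the z-derivative of
  \<open>readout 0\<close>. It gives transversality at the start z = 1 and growth of \<phi> until z
  = 3/5.\<close>

lemma readout_arc_slope:
  assumes "3/5 \<le> z" "z \<le> 1"
  shows "1/100 \<le> - amp 1 / 6 + amp 2 * z - 3 / 2 * (amp 3 * z\<^sup>2) + 2 / 3 * (amp 4 * z^3)"
proof -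
  have "1889/2000 * z \<le> amp 2 * z" "amp 3 * z\<^sup>2 \<le> (3287/5000) * z\<^sup>2" "2491/5000 * z^3 \<le> amp 4 * z^3"
    using amp_bounds assms by (auto intro!: mult_right_mono)
  moreover have "174/625 \<le> (33213/100000) * z^3 - 9861/10000 * z\<^sup>2 + (1889/2000) * z"
  proof -
    \<comment> \<open>Subtracting from the cubic its value at 3/5 and dividing by z - 3/5 leaves a
      positive quadratic with vertex near 2369/2000. The certificate is its rounded completed
      square; z^2 \<le> 1 absorbs the rounding.\<close>
    have "(z - 3/5) * ((33213/100000) * (z - 2369/2000)\<^sup>2 + (3/500)) =
        (33213/100000) * z^3 - 98609397/100000000 * z\<^sup>2 + (377632536093/400000000000) * z - 566390109879/2000000000000"
      by (simp add: power2_eq_square power3_eq_cube field_simps)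
    moreover have "0 \<le> (z - 3/5) * ((33213/100000) * (z - 2369/2000)\<^sup>2 + (3/500))"
      using assms by (intro mult_nonneg_nonneg) auto
    moreover have "z\<^sup>2 \<le> 1" using assms by (simp add: power_le_one)
    ultimately show ?thesis using assms by linarith
  qed
  moreover have "0 \<le> z^3" using assms by simp
  ultimately show ?thesis
    using amp_bounds(2) by linarith
qed

lemma readout_arc_split:
  "readout j (relay_arc d z) = readout j (relay_arc (\<lambda>_. 0) z) + readout j (\<lambda>k. d k * z ^ k)"
  by (simp add: readout_def relay_arc_def field_simps)

lemma readout_arc_0_diff:
  assumes "3/5 \<le> z" "z \<le> w" "w \<le> 1"
  shows "1/100 * (w - z) \<le> readout 0 (relay_arc (\<lambda>_. 0) z) - readout 0 (relay_arc (\<lambda>_. 0) w)"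
proof -
  define f where "f z = readout 0 (relay_arc (\<lambda>_. 0) z)" for z
  define g where "g z = - amp 1 / 6 + amp 2 * z - 3 / 2 * (amp 3 * z\<^sup>2) + 2 / 3 * (amp 4 * z^3)" for z
  have D: "(f has_real_derivative - g z) (at z)" for z
    unfolding f_def g_def readout_0 relay_arc_def
    by (auto intro!: derivative_eq_intros simp: field_simps power2_eq_square power3_eq_cube)
  show ?thesis
  proof (cases "z = w")
    case False
    then have "z < w" using assms by simp
    from MVT2[OF this D] obtain x where x: "z < x" "x < w" "f w - f z = (w - z) * - g x"
      by blast
    moreover have "1/100 * (w - z) \<le> g x * (w - z)"
      using readout_arc_slope[of x] x assms unfolding g_def by (intro mult_right_mono) auto
    ultimately show ?thesis unfolding f_def by (simp add: algebra_simps)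
  qed auto
qed

text \<open>The vertex lies to the right of z = 1, so the minimum over the unit interval is the
  value at z = 1. It is small because \<phi>' is small at the crossing.\<close>

lemma quadratic_factor_bound:
  assumes "0 \<le> z" "z \<le> 1"
  shows "29/1000 \<le> amp 4 / 6 * z\<^sup>2 + ((1 + q) * (amp 4 / 6) - amp 3 / 2) * z + 1 / (24 * q)"
proof -
  define a P b where "a = amp 4 / 6" and "P = (1 + q) * a" and "b = P - amp 3 / 2"
  have a: "83/1000 \<le> a" "a \<le> 831/10000" using amp_bounds unfolding a_def by linarith+
  have "12421/10000 * (83/1000) \<le> P" "P \<le> (12422/10000) * (831/10000)"
    unfolding P_def by (intro mult_mono; use a q_bounds in linarith)+
  then have b: "-2257/10000 \<le> b" "b \<le> -2250/10000"
    using amp_bounds unfolding b_def by linarith+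
  have c: "172/1000 \<le> 1 / (24 * q)" using q_bounds by (simp add: field_simps)
  have "0 \<le> (1 - z) * (- b - a * (1 + z))"
  proof (rule mult_nonneg_nonneg)
    have "a * (1 + z) \<le> 831/10000 * 2" using assms a by (intro mult_mono) auto
    then show "0 \<le> - b - a * (1 + z)" using b by simp
  qed (use assms in auto)
  then have "a + b \<le> a * z\<^sup>2 + b * z" by (simp add: algebra_simps power2_eq_square)
  then have "29/1000 \<le> a * z\<^sup>2 + b * z + 1 / (24 * q)" using a b c by linarith
  then show ?thesis unfolding b_def P_def a_def .
qed

lemma readout_arc_0_lower:
  assumes "q \<le> z" "z \<le> 1"
  shows "29/1000 * ((1 - z) * (z - q)) \<le> readout 0 (relay_arc (\<lambda>_. 0) z)"
  unfolding readout_arc_factor mult.commute[of "29/1000"]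
  by (intro mult_left_mono quadratic_factor_bound) (use assms q_bounds in auto)

lemma readout_arc_0_pos:
  assumes "q < z" "z < 1"
  shows "0 < readout 0 (relay_arc (\<lambda>_. 0) z)"
proof -
  have "0 < 29/1000 * ((1 - z) * (z - q))" using assms by simp
  then show ?thesis using readout_arc_0_lower[of z] assms by linarith
qed

text \<open>This concerns the formal continuation of the arc beyond the switching time: it
  overshoots linearly, which forces perturbed arcs to change sign near \<open>q\<close>.\<close>

lemma readout_arc_0_upper:
  assumes "0 \<le> z" "z \<le> q"
  shows "readout 0 (relay_arc (\<lambda>_. 0) z) \<le> - (1/100 * (q - z))"
proof -
  define Q where "Q = amp 4 / 6 * z\<^sup>2 + ((1 + q) * (amp 4 / 6) - amp 3 / 2) * z + 1 / (24 * q)"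
  have "3/4 * (29/1000) \<le> (1 - z) * Q"
    unfolding Q_def using assms quadratic_factor_bound[of z] q_bounds by (intro mult_mono) auto
  then have "1/100 * (q - z) \<le> ((1 - z) * Q) * (q - z)"
    using assms by (intro mult_right_mono) auto
  also have "\<dots> = - readout 0 (relay_arc (\<lambda>_. 0) z)"
    unfolding readout_arc_factor Q_def[symmetric] by (simp add: algebra_simps)
  finally show ?thesis by linarith
qed

section \<open>Perturbed arcs and their arrival at the switching manifold\<close>

lemma readout_0_perturbation:
  assumes "\<And>k. k \<in> {1..4} \<Longrightarrow> \<bar>d k\<bar> \<le> \<delta>" "0 \<le> z" "z \<le> 1"
  shows "\<bar>readout 0 (\<lambda>k. d k * z ^ k)\<bar> \<le> 2 * \<delta>"
    and "\<bar>readout 1 (\<lambda>k. d k * z ^ k)\<bar> \<le> 4 * \<delta>"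
proof -
  have "\<bar>d k * z ^ k\<bar> \<le> \<delta>" if "k \<in> {1..4}" for k
  proof -
    have "\<bar>d k\<bar> * z ^ k \<le> \<delta> * 1"
      using assms(1)[OF that] assms power_le_one[of z k] by (intro mult_mono) auto
    then show ?thesis using assms by (simp add: abs_mult)
  qed
  from this[of 1] this[of 2] this[of 3] this[of 4]
  show "\<bar>readout 0 (\<lambda>k. d k * z ^ k)\<bar> \<le> 2 * \<delta>" "\<bar>readout 1 (\<lambda>k. d k * z ^ k)\<bar> \<le> 4 * \<delta>"
    unfolding readout_0 readout_1 by auto
qed

lemma readout_0_perturbation_diff:
  assumes "\<And>k. k \<in> {1..4} \<Longrightarrow> \<bar>d k\<bar> \<le> \<delta>" "0 \<le> z" "z \<le> w" "w \<le> 1"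
  shows "\<bar>readout 0 (\<lambda>k. d k * z ^ k) - readout 0 (\<lambda>k. d k * w ^ k)\<bar> \<le> 4 * (\<delta> * (w - z))"
proof -
  have "\<bar>d k * z ^ k - d k * w ^ k\<bar> \<le> real k * (\<delta> * (w - z))" if "k \<in> {1..4}" for k
  proof -
    have "\<bar>d k\<bar> * \<bar>z ^ k - w ^ k\<bar> \<le> \<delta> * (real k * (w - z))"
      using assms(1)[OF that] assms norm_power_diff[of z w k] by (intro mult_mono) auto
    then show ?thesis by (simp add: abs_mult right_diff_distrib[symmetric] mult_ac)
  qed
  note this[of 1] this[of 2] this[of 3] this[of 4]
  moreover have "\<bar>(a - 3 * b + 3 * c - e) / 6\<bar> \<le> 4 * X"
    if "\<bar>a\<bar> \<le> X" "\<bar>b\<bar> \<le> 2 * X" "\<bar>c\<bar> \<le> 3 * X" "\<bar>e\<bar> \<le> 4 * X" for a b c e X :: real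
    using that by (auto simp: abs_le_iff)
  ultimately have "\<bar>((d 1 * z ^ 1 - d 1 * w ^ 1) - 3 * (d 2 * z ^ 2 - d 2 * w ^ 2) + 3 * (d 3 * z ^ 3 - d 3 * w ^ 3)
      - (d 4 * z ^ 4 - d 4 * w ^ 4)) / 6\<bar> \<le> 4 * (\<delta> * (w - z))"
    by auto
  then show ?thesis unfolding readout_0 by (simp add: field_simps)
qed

text \<open>Time runs from \<open>z0\<close> downwards. Down to 3/5 the unperturbed growth rate
  1/100 beats the perturbation rate 4 \<delta>; below 3/5 the linear bounds on both sides of
  \<open>q\<close>, against a perturbation of at most 2 \<delta>, place every relevant zero within
  200 \<delta> of \<open>q\<close>. The bounds 1/10 and 3/5 later limit the time between switchings,
  and the last conclusion lets a solution leave the manifold.\<close>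

lemma half_period_hit:
  assumes d: "\<And>k. k \<in> {1..4} \<Longrightarrow> \<bar>d k\<bar> \<le> \<delta>" and \<delta>: "0 < \<delta>" "\<delta> \<le> 1/2500"
    and z0: "q \<le> z0" "z0 \<le> 1" and pos: "0 \<le> readout 0 (relay_arc d z0)"
  obtains z where "1/10 \<le> z" "z \<le> z0" "z \<le> 3/5" "readout 0 (relay_arc d z) = 0" "\<bar>z - q\<bar> \<le> 200 * \<delta>"
    and "\<And>x. z < x \<Longrightarrow> x < z0 \<Longrightarrow> 0 < readout 0 (relay_arc d x)"
    and "z < z0 \<Longrightarrow> 0 < readout 0 (relay_arc d z0) \<or> 0 < readout 1 (relay_arc d z0)"
proof -
  define F where "F x = readout 0 (relay_arc d x)" for x
  have split: "readout 0 (relay_arc (\<lambda>_. 0) x) - 2 * \<delta> \<le> F x" "F x \<le> readout 0 (relay_arc (\<lambda>_. 0) x) + 2 * \<delta>"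
    if "0 \<le> x" "x \<le> 1" for x
  proof -
    have "\<bar>readout 0 (\<lambda>k. d k * x ^ k)\<bar> \<le> 2 * \<delta>"
      by (rule readout_0_perturbation(1)) (use d that in auto)
    then show "readout 0 (relay_arc (\<lambda>_. 0) x) - 2 * \<delta> \<le> F x" "F x \<le> readout 0 (relay_arc (\<lambda>_. 0) x) + 2 * \<delta>"
      using readout_arc_split[of 0 d x] unfolding F_def by linarith+
  qed
  have contF: "continuous_on S F" for S
    unfolding F_def readout_0 relay_arc_def by (auto intro!: continuous_intros)
  \<comment> \<open>At distance 200 \<delta> the overshoot (q - l) / 100 balances the perturbation 2
    \<delta>, so 300 \<delta> makes \<open>F l\<close> negative; \<delta> \<le> 1/2500 keeps
    \<open>l\<close> above 1/10.\<close>
  define l where "l = q - 300 * \<delta>"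
  have l: "1/10 < l" "l < q" using \<delta> q_bounds by (auto simp: l_def)
  have Fl: "F l < 0"
  proof -
    have "F l \<le> - ((1/100) * (q - l)) + 2 * \<delta>"
      using readout_arc_0_upper[of l] split[of l] l q_bounds by auto
    then show ?thesis using \<delta> by (simp add: l_def)
  qed
  have near: "\<bar>z - q\<bar> \<le> 200 * \<delta>" if z: "l \<le> z" "z \<le> 3/5" "F z = 0" for z
  proof -
    have z01: "0 \<le> z" "z \<le> 1" using z l by auto
    show ?thesis
    proof (cases "z \<le> q")
      case True
      have "readout 0 (relay_arc (\<lambda>_. 0) z) \<le> - (1/100 * (q - z))"
        by (rule readout_arc_0_upper) (use True z01 in auto)
      then have "q - z \<le> 200 * \<delta>" using split(2)[OF z01] z(3) by argo
      then show ?thesis using True by simp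
    next
      case False
      then have "29/1000 * (2/5 * (z - q)) \<le> 29/1000 * ((1 - z) * (z - q))"
        using z by (intro mult_left_mono mult_right_mono) auto
      moreover have "29/1000 * ((1 - z) * (z - q)) \<le> readout 0 (relay_arc (\<lambda>_. 0) z)"
        by (rule readout_arc_0_lower) (use False z01 in auto)
      ultimately have "z - q \<le> 200 * \<delta>" using split(1)[OF z01] z(3) False by argo
      then show ?thesis using False by simp
    qed
  qed
  have low: "\<exists>z. l \<le> z \<and> z \<le> z1 \<and> F z = 0 \<and> \<bar>z - q\<bar> \<le> 200 * \<delta> \<and> (\<forall>x. z < x \<longrightarrow> x < z1 \<longrightarrow> 0 < F x)"
    if z1: "q \<le> z1" "z1 \<le> 3/5" "0 \<le> F z1" for z1
  proof -
    \<comment> \<open>As \<open>z\<close> decreases in time, the largest zero is the first one to be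
      hit.\<close>
    define Z where "Z = {x \<in> {l..z1}. F x = 0}"
    have "closed Z" unfolding Z_def
      by (intro continuous_closed_preimage_constant contF) auto
    moreover have "bounded Z" unfolding Z_def by (rule bounded_subset[of "{l..z1}"]) auto
    ultimately have cZ: "compact Z" using compact_eq_bounded_closed by blast
    have hit: "\<exists>x. u \<le> x \<and> x \<le> z1 \<and> F x = 0" if "l \<le> u" "u \<le> z1" "F u \<le> 0" for u
      using IVT'[of F u 0 z1] that z1 contF by auto
    have "Z \<noteq> {}" using hit[of l] Fl l z1 by (force simp: Z_def)
    then obtain z where z: "z \<in> Z" "\<And>x. x \<in> Z \<Longrightarrow> x \<le> z"
      using compact_attains_sup[OF cZ] by metis
    have "0 < F x" if xz: "z < x" "x < z1" for x
    proof (rule ccontr)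
      assume "\<not> 0 < F x"
      then obtain y where "x \<le> y" "y \<le> z1" "F y = 0" using hit[of x] xz z(1) by (auto simp: Z_def)
      then show False using z(2)[of y] z(1) xz by (auto simp: Z_def)
    qed
    moreover have "\<bar>z - q\<bar> \<le> 200 * \<delta>"
      using near[of z] z(1) z1 by (simp add: Z_def)
    ultimately show ?thesis using z(1) by (auto simp: Z_def)
  qed
  show ?thesis
  proof (cases "z0 \<le> 3/5")
    case True
    then obtain z where z: "l \<le> z" "z \<le> z0" "F z = 0" "\<bar>z - q\<bar> \<le> 200 * \<delta>" "\<And>x. z < x \<Longrightarrow> x < z0 \<Longrightarrow> 0 < F x"
      using low[of z0] z0 pos unfolding F_def by metis
    show ?thesis
    proof (cases "F z0 = 0")
      \<comment> \<open>Here \<open>z0\<close> is itself the hit, after time zero, and the last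
        claim is vacuous.\<close>
      case F0: True
      have "\<bar>z0 - q\<bar> \<le> 200 * \<delta>" using near[of z0] F0 z0 True l by simp
      then show ?thesis using that[of z0] F0 z0 q_bounds True unfolding F_def by auto
    next
      case False
      then show ?thesis using that[of z] z pos l True unfolding F_def by auto
    qed
  next
    case False
    have up: "F x > F z0" if "3/5 \<le> x" "x < z0" for x
    proof -
      have "\<bar>readout 0 (\<lambda>k. d k * x ^ k) - readout 0 (\<lambda>k. d k * z0 ^ k)\<bar> \<le> 4 * (\<delta> * (z0 - x))"
        by (rule readout_0_perturbation_diff) (use d that z0 in auto)
      moreover have "\<delta> * (z0 - x) \<le> 1/2500 * (z0 - x)" using \<delta> that by (intro mult_right_mono) auto
      moreover have "1/100 * (z0 - x) \<le> readout 0 (relay_arc (\<lambda>_. 0) x) - readout 0 (relay_arc (\<lambda>_. 0) z0)"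
        using readout_arc_0_diff[of x z0] that z0 by simp
      ultimately show ?thesis
        using readout_arc_split[of 0 d x] readout_arc_split[of 0 d z0] that unfolding F_def by argo
    qed
    have F0: "0 \<le> F z0" using pos by (simp add: F_def)
    then have "0 < F (3/5)" using up[of "3/5"] False by simp
    then obtain z where z: "l \<le> z" "z \<le> 3/5" "F z = 0" "\<bar>z - q\<bar> \<le> 200 * \<delta>" "\<And>x. z < x \<Longrightarrow> x < 3/5 \<Longrightarrow> 0 < F x"
      using low[of "3/5"] q_bounds by force
    have "0 < F x" if "z < x" "x < z0" for x
      using z(5)[of x] up[of x] F0 that by (cases "x < 3/5") auto
    moreover have "0 < readout 1 (relay_arc d z0)"
    proof -
      have "readout 1 (relay_arc (\<lambda>_. 0) z0) = z0 * (- amp 1 / 6 + amp 2 * z0 - 3 / 2 * (amp 3 * z0\<^sup>2) + 2 / 3 * (amp 4 * z0^3))"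
        unfolding readout_1 relay_arc_def by (simp add: field_simps eval_nat_numeral)
      moreover have "3/5 * (1/100) \<le> \<dots>"
        using readout_arc_slope[of z0] z0 False by (intro mult_mono) auto
      moreover have "\<bar>readout 1 (\<lambda>k. d k * z0 ^ k)\<bar> \<le> 4 * \<delta>"
        by (rule readout_0_perturbation(2)) (use d z0 q_bounds in auto)
      ultimately show ?thesis
        using readout_arc_split[of 1 d z0] \<delta> by argo
    qed
    ultimately show ?thesis using that[of z] z l False unfolding F_def by auto
  qed
qed

text \<open>
  Eliminating the hitting time from the condition \<open>readout 0 = 0\<close> expresses \<open>q - z\<close> linearly through
  \<open>d\<close>. In the \<open>\<ell>\<^sup>1\<close> norm of the modes 2, 3, 4 (the first mode is determined on the switching
  manifold) the triangle inequality then already yields a factor of about 0.82.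
\<close>

lemma half_period_contraction:
  assumes tangent: "d 1 = 3 * d 2 - 3 * d 3 + d 4" and hit: "readout 0 (relay_arc d z) = 0" and z: "\<bar>z - q\<bar> \<le> 1/1000"
  shows "(\<Sum>k=2..4. \<bar>- relay_arc d z k - relay_arc (\<lambda>_. 0) 1 k\<bar>) \<le> (9/10) * (\<Sum>k=2..4. \<bar>d k\<bar>)"
proof -
  define N where "N = \<bar>d 2\<bar> + \<bar>d 3\<bar> + \<bar>d 4\<bar>"
  have N: "N \<ge> 0" by (simp add: N_def)
  have zb: "241/1000 < z" "z < 152/625" using z q_bounds unfolding abs_le_iff by linarith+
  have zp: "(241/1000)^n < z^n" "z^n < (152/625)^n" if "n > 0" for n
    using zb that by (auto intro!: power_strict_mono)
  have z2: "29/500 < z\<^sup>2" "z\<^sup>2 < 37/625" "1399/100000 < z^3" "z^3 < 1439/100000" "33/10000 < z^4" "z^4 < 1/100"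
    using zp[of 2] zp[of 3] zp[of 4] by (simp_all add: eval_nat_numeral)
  \<comment> \<open>These are the divided differences (q^k - z^k) / (q - z).\<close>
  define S2 S3 S4 where "S2 = q + z" and "S3 = q\<^sup>2 + q * z + z\<^sup>2" and "S4 = q^3 + q\<^sup>2 * z + q * z\<^sup>2 + z^3"
  have m: "2421/10000 * (241/1000) \<le> q * z" "q * z \<le> (1211/5000) * (152/625)" "q\<^sup>2 * z \<le> (587/10000) * (152/625)" "q * z\<^sup>2 \<le> (1211/5000) * (37/625)"
    "0 \<le> q\<^sup>2 * z" "0 \<le> q * z\<^sup>2"
    by (intro mult_mono mult_nonneg_nonneg; use q_bounds q_power_bounds zb z2 in linarith)+
  have S: "483/1000 < S2" "S2 < 2427/5000" "1749/10000 < S3" "S3 < 1769/10000" "0 < S4" "S4 < 573/10000"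
    unfolding S2_def S3_def S4_def using q_bounds q_power_bounds zb z2 m by linarith+
  have a: "0 \<le> amp 2 * S2" "amp 2 * S2 \<le> (9447/10000) * (2427/5000)" "1643/2500 * (1749/10000) \<le> amp 3 * S3"
     "amp 3 * S3 \<le> (3287/5000) * (1769/10000)" "0 \<le> amp 4 * S4" "amp 4 * S4 \<le> (4983/10000) * (573/10000)"
    by (intro mult_mono mult_nonneg_nonneg; use S amp_bounds in linarith)+
  \<comment> \<open>\<open>G\<close> is six times the difference quotient of the unperturbed
    \<open>readout 0\<close> between \<open>z\<close> and \<open>q\<close>; its lower bound is
    transversality at arrival. \<open>V\<close> measures how far modes 2, 3, 4 move per unit of
    error in the hit.\<close>
  define G V where "G = amp 1 - 3 * (amp 2 * S2) + 3 * (amp 3 * S3) - amp 4 * S4"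
    and "V = amp 2 * S2 + amp 3 * S3 + amp 4 * S4"
  have G: "109/200 \<le> G" and V: "0 \<le> V" "V \<le> 3019/5000"
    unfolding G_def V_def using a amp_bounds by linarith+
  have pw: "q\<^sup>2 - z\<^sup>2 = (q - z) * S2" "q^3 - z^3 = (q - z) * S3" "q^4 - z^4 = (q - z) * S4"
    unfolding S2_def S3_def S4_def by algebra+
  have zero: "readout 0 (relay_arc (\<lambda>_. 0) q) = 0" by (simp add: readout_arc_factor)
  have key: "(q - z) * G = d 1 * z - 3 * (d 2 * z\<^sup>2) + 3 * (d 3 * z^3) - d 4 * z^4"
  proof -
    have "readout 0 (relay_arc d z) - readout 0 (relay_arc (\<lambda>_. 0) q) =
       (d 1 * z - 3 * (d 2 * z\<^sup>2) + 3 * (d 3 * z^3) - d 4 * z^4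
        - (amp 1 * (q - z) - 3 * (amp 2 * (q\<^sup>2 - z\<^sup>2)) + 3 * (amp 3 * (q^3 - z^3)) - amp 4 * (q^4 - z^4))) / 6"
      unfolding readout_0 relay_arc_def by (simp add: field_simps)
    also have "amp 1 * (q - z) - 3 * (amp 2 * (q\<^sup>2 - z\<^sup>2)) + 3 * (amp 3 * (q^3 - z^3)) - amp 4 * (q^4 - z^4) = (q - z) * G"
      unfolding pw G_def by (simp add: algebra_simps)
    finally show ?thesis using hit zero by simp
  qed
  have "d 1 * z - 3 * (d 2 * z\<^sup>2) + 3 * (d 3 * z^3) - d 4 * z^4 =
      3 * (z - z\<^sup>2) * d 2 - 3 * (z - z^3) * d 3 + (z - z^4) * d 4"
    unfolding tangent by (simp add: algebra_simps)
  also have "\<bar>\<dots>\<bar> \<le> (6877/10000) * N"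
  proof -
    \<comment> \<open>The largest of the three is 3 (z - z^3), which determines the
      constant.\<close>
    have c: "\<bar>3 * (z - z\<^sup>2)\<bar> \<le> 6877/10000" "\<bar>3 * (z - z^3)\<bar> \<le> 6877/10000" "\<bar>z - z^4\<bar> \<le> 6877/10000"
      using zb z2 by (simp_all add: abs_le_iff)
    have "\<bar>3 * (z - z\<^sup>2) * d 2\<bar> \<le> 6877/10000 * \<bar>d 2\<bar>" "\<bar>3 * (z - z^3) * d 3\<bar> \<le> 6877/10000 * \<bar>d 3\<bar>"
       "\<bar>(z - z^4) * d 4\<bar> \<le> 6877/10000 * \<bar>d 4\<bar>"
      unfolding abs_mult[of "3 * (z - z\<^sup>2)"] abs_mult[of "3 * (z - z^3)"] abs_mult[of "z - z^4"]
      by (intro mult_right_mono c abs_ge_zero)+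
    moreover have "\<bar>a - b + c\<bar> \<le> \<bar>a\<bar> + \<bar>b\<bar> + \<bar>c\<bar>" for a b c :: real
      by linarith
    ultimately show ?thesis
      unfolding N_def distrib_left by (meson add_mono order_trans)
  qed
  finally have "\<bar>q - z\<bar> * G \<le> (6877/10000) * N" using key G by (metis abs_mult abs_of_nonneg order.trans zero_le_divide_iff zero_le_numeral)
  moreover have "\<bar>q - z\<bar> * (109/200) \<le> \<bar>q - z\<bar> * G" using G by (intro mult_left_mono) auto
  moreover have "x \<le> 631/500 * N" if "x * G \<le> 6877/10000 * N" "x * (109/200) \<le> x * G" for x
    using that N by linarith
  ultimately have qz: "\<bar>q - z\<bar> \<le> 631/500 * N" by blast
  then have qV: "\<bar>q - z\<bar> * V \<le> (631/500) * N * (3019/5000)" using V N by (intro mult_mono) auto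
  have neg: "- relay_arc d z k - relay_arc (\<lambda>_. 0) 1 k = amp k * (q ^ k - z ^ k) - d k * z ^ k" if "k > 0" for k
    using amp_q[OF that] by (simp add: relay_arc_def algebra_simps)
  have b: "\<bar>- relay_arc d z k - relay_arc (\<lambda>_. 0) 1 k\<bar> \<le> \<bar>q - z\<bar> * (amp k * S) + 37/625 * \<bar>d k\<bar>"
    if k: "k \<in> {2..4}" and S: "q ^ k - z ^ k = (q - z) * S" "0 \<le> S" for k S
  proof -
    have "z ^ k \<le> z ^ 2" using k zb by (intro power_decreasing) auto
    then have "z ^ k * \<bar>d k\<bar> \<le> 37/625 * \<bar>d k\<bar>" using z2 by (intro mult_right_mono) auto
    moreover have "\<bar>d k * z ^ k\<bar> = z ^ k * \<bar>d k\<bar>" using zb by (simp add: abs_mult)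
    moreover have "amp k \<ge> 0" using q_bounds by (simp add: amp_def)
    then have "\<bar>amp k * ((q - z) * S)\<bar> = \<bar>q - z\<bar> * (amp k * S)" using S by (simp add: abs_mult)
    moreover have "- relay_arc d z k - relay_arc (\<lambda>_. 0) 1 k = amp k * ((q - z) * S) - d k * z ^ k"
      using neg[of k] k S by simp
    ultimately show ?thesis
      using abs_triangle_ineq4[of "amp k * ((q - z) * S)" "d k * z ^ k"] by simp
  qed
  have sum3: "(\<Sum>k=2..4. h k) = h 2 + h 3 + h (4::nat)" for h :: "nat \<Rightarrow> real"
    by (simp add: eval_nat_numeral)
  have "(\<Sum>k=2..4. \<bar>- relay_arc d z k - relay_arc (\<lambda>_. 0) 1 k\<bar>) \<le> \<bar>q - z\<bar> * V + 37/625 * N"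
    using b[of 2 S2] b[of 3 S3] b[of 4 S4] S unfolding sum3 V_def N_def distrib_left
    by (simp add: pw)
  moreover have "x \<le> 9/10 * N" if "x \<le> y + 37/625 * N" "y \<le> 631/500 * N * (3019/5000)" for x y
    using that N by argo
  ultimately show ?thesis using qV unfolding sum3 N_def[symmetric] by blast
qed

lemma readout_cong: "(\<And>k. k \<in> {1..4} \<Longrightarrow> v k = w k) \<Longrightarrow> readout j v = readout j w"
  by (simp add: readout_def)

lemma readout_uminus: "readout j (\<lambda>k. - v k) = - readout j v"
  unfolding readout_def mult_minus_right by argo

subsection \<open>Stability of the periodic orbit in mode coordinates\<close>

text \<open>
  No condition is imposed at the zeros of \<open>\<phi>\<close>: near the orbit they are crossed transversally, so the
  flow between consecutive zeros determines everything.
\<close>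

definition trajectory :: "(real \<Rightarrow> nat \<Rightarrow> real) \<Rightarrow> bool" where
  "trajectory y \<longleftrightarrow>
     (\<forall>s\<ge>0. ((\<lambda>s. readout 0 (y s)) has_real_derivative readout 1 (y s)) (at s within {0..})) \<and>
     (\<forall>\<sigma>\<in>{-1, 1}. \<forall>a\<ge>0. \<forall>b. (\<forall>s\<in>{a<..<b}. 0 < \<sigma> * readout 0 (y s)) \<longrightarrow>
        (\<forall>s\<in>{a..b}. \<forall>k\<in>{1..4}.
           \<sigma> * y s k = - 1 / real k + (\<sigma> * y a k + 1 / real k) * exp (- (real k * (s - a)))))"

lemma trajectory_uminus:
  assumes "trajectory y"
  shows "trajectory (\<lambda>s k. - y s k)"
  unfolding trajectory_def
proof (intro conjI allI impI ballI)
  fix s :: real assume "0 \<le> s"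
  then have "((\<lambda>s. readout 0 (y s)) has_real_derivative readout 1 (y s)) (at s within {0..})"
    using assms by (simp add: trajectory_def)
  then show "((\<lambda>s. readout 0 (\<lambda>k. - y s k)) has_real_derivative readout 1 (\<lambda>k. - y s k)) (at s within {0..})"
    unfolding readout_uminus by (rule DERIV_minus)
next
  fix \<sigma> a b s :: real and k
  assume *: "\<sigma> \<in> {-1, 1}" "0 \<le> a" "\<forall>s\<in>{a<..<b}. 0 < \<sigma> * readout 0 (\<lambda>k. - y s k)" "s \<in> {a..b}" "k \<in> {1..4::nat}"
  have "- \<sigma> \<in> {-1, 1}" "\<forall>s\<in>{a<..<b}. 0 < - \<sigma> * readout 0 (y s)"
    using * by (auto simp: readout_uminus)
  then have "- \<sigma> * y s k = - 1 / real k + (- \<sigma> * y a k + 1 / real k) * exp (- (real k * (s - a)))"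
    using assms *(2,4,5) unfolding trajectory_def by blast
  then show "\<sigma> * - y s k = - 1 / real k + (\<sigma> * - y a k + 1 / real k) * exp (- (real k * (s - a)))"
    by simp
qed

lemma trajectory_flow:
  assumes "trajectory y" "0 \<le> a" "\<And>s. a < s \<Longrightarrow> s < b \<Longrightarrow> 0 < readout 0 (y s)"
    and y: "\<And>k. k \<in> {1..4} \<Longrightarrow> y a k = relay_arc d z k" and s: "a \<le> s" "s \<le> b" and k: "k \<in> {1..4}"
  shows "y s k = relay_arc d (z * exp (- (s - a))) k"
proof -
  have "(1::real) \<in> {-1, 1}" by simp
  note traj = assms(1)[unfolded trajectory_def, THEN conjunct2, THEN bspec, OF this, THEN spec, THEN mp,
      OF assms(2), THEN spec[of _ b], THEN mp]
  have "\<forall>s\<in>{a<..<b}. 0 < 1 * readout 0 (y s)" using assms(3) by simp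
  from traj[OF this] have "1 * y s k = - 1 / real k + (1 * y a k + 1 / real k) * exp (- (real k * (s - a)))"
    using s k by (simp only: atLeastAtMost_iff)
  moreover have "exp (- (real k * (s - a))) = exp (- (s - a)) ^ k"
    unfolding exp_of_nat_mult[symmetric] mult_minus_right ..
  ultimately show ?thesis using y[OF k] by (simp add: relay_arc_def power_mult_distrib)
qed

text \<open>The formula presupposes \<phi> > 0, so positivity comes first: \<phi> is positive just
  after \<open>a\<close> by continuity or by its positive derivative, and at a first later time with
  \<phi> \<le> 0 the formula would still hold and give \<phi> > 0.\<close>

lemma trajectory_follows_arc:
  assumes traj: "trajectory y" and a: "0 \<le> a" and z: "0 < z" "z \<le> z0"
    and y: "\<And>k. k \<in> {1..4} \<Longrightarrow> y a k = relay_arc d z0 k"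
    and nonneg: "0 \<le> readout 0 (relay_arc d z0)"
    and pos: "\<And>x. z < x \<Longrightarrow> x < z0 \<Longrightarrow> 0 < readout 0 (relay_arc d x)"
    and start: "z < z0 \<Longrightarrow> 0 < readout 0 (relay_arc d z0) \<or> 0 < readout 1 (relay_arc d z0)"
    and t: "0 \<le> t" "t \<le> ln (z0 / z)" and k: "k \<in> {1..4}"
  shows "y (a + t) k = relay_arc d (z0 * exp (- t)) k"
proof (cases "z = z0")
  case True
  then show ?thesis using t z y[OF k] by simp
next
  case False
  then have zz: "z < z0" using z by simp
  define L where "L = ln (z0 / z)"
  define \<psi> where "\<psi> s = readout 0 (y s)" for s
  have L: "0 < L" using zz z by (simp add: L_def)
  have deriv: "(\<psi> has_real_derivative readout 1 (y s)) (at s within {0..})" if "0 \<le> s" for s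
    using traj that unfolding trajectory_def \<psi>_def by blast
  then have cont: "continuous_on {0..} \<psi>"
    by (auto simp: continuous_on_eq_continuous_within intro!: DERIV_continuous)
  have \<psi>a: "\<psi> a = readout 0 (relay_arc d z0)" unfolding \<psi>_def by (rule readout_cong[OF y])
  have \<psi>'a: "readout 1 (y a) = readout 1 (relay_arc d z0)" by (rule readout_cong[OF y])
  have "\<exists>e>0. \<forall>s. a < s \<longrightarrow> s < a + e \<longrightarrow> 0 < \<psi> s"
  proof (cases "0 < \<psi> a")
    case True
    obtain e where e: "e > 0" "\<And>s. 0 \<le> s \<Longrightarrow> dist s a < e \<Longrightarrow> dist (\<psi> s) (\<psi> a) < \<psi> a"
      using cont True a unfolding continuous_on_iff by (metis atLeast_iff)
    have "0 < \<psi> s" if "a < s" "s < a + e" for s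
    proof -
      have "\<bar>\<psi> s - \<psi> a\<bar> < \<psi> a" using e(2)[of s] that a by (simp add: dist_real_def)
      then show ?thesis by linarith
    qed
    then show ?thesis using e(1) by blast
  next
    case False
    then have "0 < readout 1 (y a)" using start[OF zz] \<psi>a \<psi>'a by auto
    then obtain e where "e > 0" "\<And>h. 0 < h \<Longrightarrow> a + h \<in> {0..} \<Longrightarrow> h < e \<Longrightarrow> \<psi> a < \<psi> (a + h)"
      using has_real_derivative_pos_inc_right[OF deriv[OF a]] by blast
    then have inc: "0 < h \<Longrightarrow> h < e \<Longrightarrow> \<psi> a < \<psi> (a + h)" and "e > 0" for h using a by auto
    have "0 < \<psi> s" if "a < s" "s < a + e" for s
      using inc[of "s - a"] that nonneg \<psi>a by simp
    then show ?thesis using \<open>e > 0\<close> by blast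
  qed
  then obtain e where e: "e > 0" "\<And>s. a < s \<Longrightarrow> s < a + e \<Longrightarrow> 0 < \<psi> s" by blast
  have posL: "0 < \<psi> s" if s: "a < s" "s < a + L" for s
  proof (rule ccontr)
    assume neg: "\<not> 0 < \<psi> s"
    \<comment> \<open>Starting at a + e/2 keeps away from \<open>a\<close>, where \<phi> may vanish,
      and makes the set compact, so that a first bad time exists.\<close>
    define M where "M = {r \<in> {a + e/2..s}. \<psi> r \<le> 0}"
    have M: "M = {a + e/2..s} \<inter> \<psi> -` {..0}" by (auto simp: M_def)
    have "continuous_on {a + e/2..s} \<psi>" by (rule continuous_on_subset[OF cont]) (use a e(1) in auto)
    then have "closed M" unfolding M by (rule continuous_closed_preimage) auto
    moreover have "bounded M" by (rule bounded_subset[OF bounded_closed_interval[of "a + e/2" s]]) (simp add: M)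
    ultimately have "compact M" using compact_eq_bounded_closed by blast
    have "\<not> s < a + e" using neg e(2)[of s] s by blast
    then have "s \<in> M" using neg e(1) by (simp add: M_def)
    then obtain m where m: "m \<in> M" "\<And>r. r \<in> M \<Longrightarrow> m \<le> r"
      using compact_attains_inf[OF \<open>compact M\<close>] by blast
    have ma: "a < m" "m \<le> s" using m e(1) by (auto simp: M_def)
    have posm: "0 < \<psi> r" if "a < r" "r < m" for r
    proof (cases "r < a + e")
      case False
      then have "r \<notin> M" "r \<in> {a + e/2..s}" using m(2)[of r] that ma e(1) by auto
      then show ?thesis by (auto simp: M_def)
    qed (use e that in auto)
    have "y m k = relay_arc d (z0 * exp (- (m - a))) k" if "k \<in> {1..4}" for k
    proof (rule trajectory_flow[OF traj a _ y])
      show "0 < readout 0 (y r)" if "a < r" "r < m" for r using posm[OF that] unfolding \<psi>_def .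
    qed (use ma that in auto)
    then have "\<psi> m = readout 0 (relay_arc d (z0 * exp (- (m - a))))"
      unfolding \<psi>_def by (rule readout_cong)
    moreover have "z < z0 * exp (- (m - a))"
    proof -
      have "exp (- L) = z / z0" unfolding L_def using z zz by (simp add: exp_minus)
      then have "z = z0 * exp (- L)" using z zz by simp
      also have "\<dots> < z0 * exp (- (m - a))" using z zz ma s by (intro mult_strict_left_mono) auto
      finally show ?thesis .
    qed
    moreover have "z0 * exp (- (m - a)) < z0" using z zz ma by simp
    ultimately have "0 < \<psi> m" using pos by simp
    then show False using m(1) by (simp add: M_def)
  qed
  have tL: "t \<le> L" using t(2) unfolding L_def .
  have "y (a + t) k = relay_arc d (z0 * exp (- (a + t - a))) k"
  proof (rule trajectory_flow[OF traj a _ y])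
    show "0 < readout 0 (y s)" if "a < s" "s < a + L" for s using posL[OF that] unfolding \<psi>_def .
    show "a \<le> a + t" "a + t \<le> a + L" using t(1) tL by simp_all
  qed (use k in auto)
  then show ?thesis by simp
qed

section \<open>Neighbourhoods of the orbit and the half-return map\<close>

definition near_orbit :: "(nat \<Rightarrow> real) \<Rightarrow> real \<Rightarrow> bool" where
  "near_orbit v e \<longleftrightarrow> (\<exists>\<sigma>\<in>{-1, 1}. \<exists>z\<in>{q..1}. \<forall>k\<in>{1..4}. \<bar>\<sigma> * v k - relay_arc (\<lambda>_. 0) z k\<bar> \<le> e)"

text \<open>This is the norm in which the half return contracts; mode 1 is recovered from
  \<open>readout 0 v = 0\<close>. The sign \<sigma> merges the two crossing points, so a half period
  leads from the set to itself.\<close>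

definition near_section :: "(nat \<Rightarrow> real) \<Rightarrow> real \<Rightarrow> bool" where
  "near_section v \<rho> \<longleftrightarrow> readout 0 v = 0 \<and>
     (\<exists>\<sigma>\<in>{-1, 1}. (\<Sum>k=2..4. \<bar>\<sigma> * v k - relay_arc (\<lambda>_. 0) 1 k\<bar>) \<le> \<rho>)"

lemma bex_sign_uminus: "(\<exists>\<sigma>\<in>{-1, 1}. P (- \<sigma>)) \<longleftrightarrow> (\<exists>\<sigma>\<in>{-1, 1::real}. P \<sigma>)"
  by auto

lemma near_orbit_uminus: "near_orbit (\<lambda>k. - v k) e \<longleftrightarrow> near_orbit v e"
  unfolding near_orbit_def mult_minus_right mult_minus_left[symmetric]
  by (rule bex_sign_uminus)

lemma near_section_uminus: "near_section (\<lambda>k. - v k) e \<longleftrightarrow> near_section v e"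
  unfolding near_section_def readout_uminus neg_equal_0_iff_equal mult_minus_right mult_minus_left[symmetric]
  by (rule arg_cong[OF bex_sign_uminus])

lemma near_orbit_mono: "near_orbit v e \<Longrightarrow> e \<le> e' \<Longrightarrow> near_orbit v e'"
  unfolding near_orbit_def by (meson order_trans)

lemma near_section_mono: "near_section v \<rho> \<Longrightarrow> \<rho> \<le> \<rho>' \<Longrightarrow> near_section v \<rho>'"
  unfolding near_section_def by (meson order_trans)

lemma amp_le_2: "0 \<le> amp k" "k > 0 \<Longrightarrow> amp k \<le> 2"
proof -
  have "0 \<le> q ^ k" using q_bounds by simp
  then show "0 \<le> amp k" by (simp add: amp_def)
  assume "k > 0"
  then have "1 * 1 \<le> real k * (1 + q ^ k)" using \<open>0 \<le> q ^ k\<close> by (intro mult_mono) auto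
  then show "amp k \<le> 2" by (simp add: amp_def field_simps)
qed

lemma arc_diff:
  assumes "k \<in> {1..4}" "0 \<le> x" "x \<le> 1" "0 \<le> w" "w \<le> 1"
  shows "\<bar>relay_arc (\<lambda>_. 0) x k - relay_arc (\<lambda>_. 0) w k\<bar> \<le> 8 * \<bar>x - w\<bar>"
proof -
  have "\<bar>x ^ k - w ^ k\<bar> \<le> real k * \<bar>x - w\<bar>"
    using norm_power_diff[of x w k] assms by simp
  also have "\<dots> \<le> 4 * \<bar>x - w\<bar>" using assms by (intro mult_right_mono) auto
  finally have "amp k * \<bar>x ^ k - w ^ k\<bar> \<le> 2 * (4 * \<bar>x - w\<bar>)"
    using assms amp_le_2[of k] by (intro mult_mono) auto
  then show ?thesis using amp_le_2(1)[of k]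
    by (simp add: relay_arc_def abs_mult right_diff_distrib[symmetric])
qed

lemma arc_perturbation:
  assumes "\<bar>d k\<bar> \<le> \<delta>" "0 \<le> x" "x \<le> 1"
  shows "\<bar>relay_arc d x k - relay_arc (\<lambda>_. 0) x k\<bar> \<le> \<delta>"
proof -
  have "\<bar>d k\<bar> * x ^ k \<le> \<delta> * 1"
    using assms power_le_one[of x k] by (intro mult_mono) auto
  then show ?thesis using assms by (simp add: relay_arc_def algebra_simps abs_mult)
qed

lemma near_orbit_arc:
  assumes d: "\<And>k. k \<in> {1..4} \<Longrightarrow> \<bar>d k\<bar> \<le> \<delta>" and x: "0 \<le> z" "z \<le> x" "x \<le> 1" and z: "\<bar>z - q\<bar> \<le> 200 * \<delta>"
  shows "near_orbit (relay_arc d x) (2000 * \<delta>)"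
proof -
  have \<delta>: "0 \<le> \<delta>" using z by linarith
  \<comment> \<open>A late hit lets \<open>x\<close> fall below \<open>q\<close>; clipping at
    \<open>q\<close> costs 8 * 200 \<delta> by \<open>arc_diff\<close>, and the perturbation adds
    \<delta>.\<close>
  have "\<bar>relay_arc d x k - relay_arc (\<lambda>_. 0) (max x q) k\<bar> \<le> 2000 * \<delta>" if k: "k \<in> {1..4}" for k
  proof -
    have "\<bar>x - max x q\<bar> \<le> 200 * \<delta>" using x z by (auto simp: max_def)
    moreover have "\<bar>relay_arc (\<lambda>_. 0) x k - relay_arc (\<lambda>_. 0) (max x q) k\<bar> \<le> 8 * \<bar>x - max x q\<bar>"
      using k x q_bounds by (intro arc_diff) auto
    moreover have "\<bar>relay_arc d x k - relay_arc (\<lambda>_. 0) x k\<bar> \<le> \<delta>"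
      using d[OF k] x by (intro arc_perturbation) auto
    ultimately show ?thesis using \<delta> by argo
  qed
  moreover have "max x q \<in> {q..1}" using x q_bounds by auto
  ultimately show ?thesis unfolding near_orbit_def by (intro bexI[of _ 1] bexI[of _ "max x q"]) auto
qed

lemma readout_0_section: "readout 0 (relay_arc (\<lambda>_. 0) 1) = 0"
  by (simp add: readout_arc_factor)

text \<open>Mode 1 enters with perturbation at most 3 \<rho>, so the hit is within 600 \<rho> \<le>
  1/1000 of \<open>q\<close>, the range of \<open>half_period_contraction\<close>. The lower time
  bound excludes accumulation of switchings, the upper one gives a rate of decay.\<close>

lemma half_return:
  assumes traj: "trajectory y" and s: "0 \<le> s" and \<rho>: "0 < \<rho>" "\<rho> \<le> 1/600000"
    and sec: "near_section (y s) \<rho>"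
  shows "\<exists>s'. s + ln (5/3) \<le> s' \<and> s' \<le> s + ln 10 \<and> near_section (y s') (9/10 * \<rho>) \<and>
    (\<forall>t\<in>{s..s'}. near_orbit (y t) (6000 * \<rho>))"
proof -
  have wlog: "\<exists>s'. s + ln (5/3) \<le> s' \<and> s' \<le> s + ln 10 \<and> near_section (y s') (9/10 * \<rho>) \<and>
    (\<forall>t\<in>{s..s'}. near_orbit (y t) (6000 * \<rho>))"
    if traj: "trajectory y" and r0: "readout 0 (y s) = 0" and sum: "(\<Sum>k=2..4. \<bar>y s k - relay_arc (\<lambda>_. 0) 1 k\<bar>) \<le> \<rho>" for y
  proof -
    define d where "d k = y s k - relay_arc (\<lambda>_. 0) 1 k" for k
    have yd: "y s k = relay_arc d 1 k" for k by (simp add: d_def relay_arc_def)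
    have dsum: "(\<Sum>k=2..4. \<bar>d k\<bar>) \<le> \<rho>" using sum by (simp add: d_def)
    then have b: "\<bar>d 2\<bar> + \<bar>d 3\<bar> + \<bar>d 4\<bar> \<le> \<rho>" by (simp add: eval_nat_numeral)
    have rd: "readout 0 (relay_arc d 1) = 0" using r0 yd by (simp add: readout_def)
    then have tangent: "d 1 = 3 * d 2 - 3 * d 3 + d 4"
      using readout_arc_split[of 0 d 1] readout_0_section by (simp add: readout_0)
    have d: "\<bar>d k\<bar> \<le> 3 * \<rho>" if "k \<in> {1..4}" for k
    proof -
      have "\<bar>d 1\<bar> \<le> 3 * \<rho>" "\<bar>d 2\<bar> \<le> 3 * \<rho>" "\<bar>d 3\<bar> \<le> 3 * \<rho>" "\<bar>d 4\<bar> \<le> 3 * \<rho>"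
        using b tangent by argo+
      moreover have "k = 1 \<or> k = 2 \<or> k = 3 \<or> k = 4" using that by auto
      ultimately show ?thesis by blast
    qed
    obtain z where z: "1/10 \<le> z" "z \<le> 1" "z \<le> 3/5" "readout 0 (relay_arc d z) = 0" "\<bar>z - q\<bar> \<le> 200 * (3 * \<rho>)"
      and pos: "\<And>x. z < x \<Longrightarrow> x < 1 \<Longrightarrow> 0 < readout 0 (relay_arc d x)"
      and start: "z < 1 \<Longrightarrow> 0 < readout 0 (relay_arc d 1) \<or> 0 < readout 1 (relay_arc d 1)"
      by (rule half_period_hit[of d "3 * \<rho>" 1]) (use d \<rho> q_bounds rd in auto)
    define L where "L = ln (1 / z)"
    have flow: "y (s + t) k = relay_arc d (exp (- t)) k" if "0 \<le> t" "t \<le> L" "k \<in> {1..4}" for t k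
    proof -
      have "y (s + t) k = relay_arc d (1 * exp (- t)) k"
        by (rule trajectory_follows_arc[OF traj s _ z(2) yd _ pos start])
          (use rd z(1) that in \<open>auto simp only: L_def order_refl\<close>)
      then show ?thesis by simp
    qed
    have expL: "exp (- L) = z" unfolding L_def using z by (simp add: exp_minus)
    have L: "0 \<le> L" unfolding L_def using z by simp
    have end_: "y (s + L) k = relay_arc d z k" if "k \<in> {1..4}" for k
      using flow[OF L order_refl that] unfolding expL .
    have "near_section (y (s + L)) (9/10 * \<rho>)"
      unfolding near_section_def
    proof
      show "readout 0 (y (s + L)) = 0" using readout_cong[OF end_] z(4) by simp
      have "(\<Sum>k=2..4. \<bar>- 1 * y (s + L) k - relay_arc (\<lambda>_. 0) 1 k\<bar>) = (\<Sum>k=2..4. \<bar>- relay_arc d z k - relay_arc (\<lambda>_. 0) 1 k\<bar>)"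
        using end_ by (intro sum.cong) auto
      also have "\<dots> \<le> 9/10 * (\<Sum>k=2..4. \<bar>d k\<bar>)"
        by (rule half_period_contraction[OF tangent z(4)]) (use z(5) \<rho> in linarith)
      also have "\<dots> \<le> 9/10 * \<rho>" using dsum by simp
      finally show "\<exists>\<sigma>\<in>{-1, 1}. (\<Sum>k=2..4. \<bar>\<sigma> * y (s + L) k - relay_arc (\<lambda>_. 0) 1 k\<bar>) \<le> 9/10 * \<rho>"
        by (intro bexI[of _ "-1"]) auto
    qed
    moreover have "near_orbit (y t) (6000 * \<rho>)" if "t \<in> {s..s + L}" for t
    proof -
      have "z \<le> exp (- (t - s))" unfolding expL[symmetric] using that by simp
      then have "near_orbit (relay_arc d (exp (- (t - s)))) (2000 * (3 * \<rho>))"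
        using that z by (intro near_orbit_arc[OF d]) auto
      moreover have "\<And>k. k \<in> {1..4} \<Longrightarrow> y t k = relay_arc d (exp (- (t - s))) k"
        using flow[of "t - s"] that by simp
      ultimately show ?thesis unfolding near_orbit_def by simp
    qed
    moreover have "ln (5/3) \<le> L" "L \<le> ln 10"
      unfolding L_def using z by (simp_all add: field_simps)
    ultimately show ?thesis by (intro exI[of _ "s + L"]) auto
  qed
  from sec obtain \<sigma> where \<sigma>: "\<sigma> \<in> {-1, 1}" "(\<Sum>k=2..4. \<bar>\<sigma> * y s k - relay_arc (\<lambda>_. 0) 1 k\<bar>) \<le> \<rho>" and r0: "readout 0 (y s) = 0"
    unfolding near_section_def by blast
  show ?thesis
  proof (cases "\<sigma> = 1")
    case True
    then show ?thesis using wlog[OF traj r0] \<sigma>(2) by (simp only: mult_1)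
  next
    case False
    then have "\<sigma> = -1" using \<sigma>(1) by blast
    then have "(\<Sum>k=2..4. \<bar>- y s k - relay_arc (\<lambda>_. 0) 1 k\<bar>) \<le> \<rho>"
      using \<sigma>(2) by (simp only: mult_minus1)
    moreover have "readout 0 (\<lambda>k. - y s k) = 0" using r0 by (simp only: readout_uminus minus_zero)
    ultimately show ?thesis
      using wlog[OF trajectory_uminus[OF traj]] by (simp only: near_orbit_uminus near_section_uminus)
  qed
qed

text \<open>A start anywhere near the orbit follows a perturbed arc to its first hit. The delicate
  case is a start near a crossing, where the nearby half orbit and \<phi> have opposite signs; the
  start is then compared with the adjacent end of the other half.\<close>

lemma reach_section:
  assumes traj: "trajectory y" and e: "0 < e" "e \<le> 1 / 10^10" and near: "near_orbit (y 0) e"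
  shows "\<exists>s\<ge>0. near_section (y s) (10^10 * e) \<and> (\<forall>t\<in>{0..s}. near_orbit (y t) (10^10 * e))"
proof -
  have wlog: "\<exists>s\<ge>0. near_section (y s) (5000 * \<delta>) \<and> (\<forall>t\<in>{0..s}. near_orbit (y t) (2000 * \<delta>))"
    if traj: "trajectory y" and r0: "0 \<le> readout 0 (y 0)" and z0: "q \<le> z0" "z0 \<le> 1"
      and \<delta>: "0 < \<delta>" "\<delta> \<le> 1/2500" and near: "\<And>k. k \<in> {1..4} \<Longrightarrow> \<bar>y 0 k - relay_arc (\<lambda>_. 0) z0 k\<bar> \<le> 3/1000 * \<delta>"
    for y z0 \<delta>
  proof -
    have z0p: "0 < z0" using z0 q_bounds by simp
    \<comment> \<open>In \<open>relay_arc\<close> the perturbation is normalised at z = 1, so the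
      deviation at \<open>z0\<close> is scaled back. Since z0^k \<ge> q^4 > 3/1000, this magnifies
      it by at most 1000/3.\<close>
    define d where "d k = (y 0 k - relay_arc (\<lambda>_. 0) z0 k) / z0 ^ k" for k
    have yd: "y 0 k = relay_arc d z0 k" for k using z0p by (simp add: d_def relay_arc_def field_simps)
    have d: "\<bar>d k\<bar> \<le> \<delta>" if k: "k \<in> {1..4}" for k
    proof -
      have "q ^ 4 \<le> z0 ^ 4" using z0 q_bounds by (intro power_mono) auto
      then have "3/1000 \<le> z0 ^ 4" using q_power_bounds(5) by linarith
      also have "\<dots> \<le> z0 ^ k" using k z0 z0p by (intro power_decreasing) auto
      finally have "3/1000 * \<delta> \<le> z0 ^ k * \<delta>" using \<delta> by (intro mult_right_mono) auto
      then have "\<bar>y 0 k - relay_arc (\<lambda>_. 0) z0 k\<bar> \<le> z0 ^ k * \<delta>" using near[OF k] by linarith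
      then show ?thesis using z0p by (simp add: d_def field_simps)
    qed
    have rd: "0 \<le> readout 0 (relay_arc d z0)" using r0 yd by (simp add: readout_def)
    obtain z where z: "1/10 \<le> z" "z \<le> z0" "z \<le> 3/5" "readout 0 (relay_arc d z) = 0" "\<bar>z - q\<bar> \<le> 200 * \<delta>"
      and pos: "\<And>x. z < x \<Longrightarrow> x < z0 \<Longrightarrow> 0 < readout 0 (relay_arc d x)"
      and start: "z < z0 \<Longrightarrow> 0 < readout 0 (relay_arc d z0) \<or> 0 < readout 1 (relay_arc d z0)"
      by (rule half_period_hit[of d \<delta> z0]) (use d \<delta> z0 rd in auto)
    define L where "L = ln (z0 / z)"
    have L: "0 \<le> L" unfolding L_def using z by simp
    have flow: "y t k = relay_arc d (z0 * exp (- t)) k" if "0 \<le> t" "t \<le> L" "k \<in> {1..4}" for t k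
    proof -
      have "y (0 + t) k = relay_arc d (z0 * exp (- t)) k"
        by (rule trajectory_follows_arc[OF traj order_refl _ z(2) yd rd pos start])
          (use z(1) that in \<open>auto simp only: L_def\<close>)
      then show ?thesis by simp
    qed
    have expL: "z0 * exp (- L) = z" unfolding L_def using z z0p by (simp add: exp_minus)
    have end_: "y L k = relay_arc d z k" if "k \<in> {1..4}" for k
      using flow[OF L order_refl that] unfolding expL .
    have "near_section (y L) (5000 * \<delta>)"
      unfolding near_section_def
    proof
      show "readout 0 (y L) = 0" using readout_cong[OF end_] z(4) by simp
      have "\<bar>- 1 * y L k - relay_arc (\<lambda>_. 0) 1 k\<bar> \<le> 1601 * \<delta>" if "k \<in> {2..4}" for k
      proof -
        have k: "k \<in> {1..4}" using that by auto
        have "\<bar>relay_arc d z k - relay_arc (\<lambda>_. 0) z k\<bar> \<le> \<delta>" using d[OF k] z by (intro arc_perturbation) auto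
        moreover have "\<bar>relay_arc (\<lambda>_. 0) z k - relay_arc (\<lambda>_. 0) q k\<bar> \<le> 8 * \<bar>z - q\<bar>"
          using k z q_bounds by (intro arc_diff) auto
        moreover have "relay_arc (\<lambda>_. 0) q k = - relay_arc (\<lambda>_. 0) 1 k" using k by (intro arc_q) auto
        ultimately show ?thesis using end_[OF k] z(5) by argo
      qed
      then have "(\<Sum>k=2..4. \<bar>- 1 * y L k - relay_arc (\<lambda>_. 0) 1 k\<bar>) \<le> (\<Sum>k=2..(4::nat). 1601 * \<delta>)"
        by (rule sum_mono)
      also have "\<dots> \<le> 5000 * \<delta>" using \<delta> by simp
      finally show "\<exists>\<sigma>\<in>{-1, 1}. (\<Sum>k=2..4. \<bar>\<sigma> * y L k - relay_arc (\<lambda>_. 0) 1 k\<bar>) \<le> 5000 * \<delta>"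
        by (intro bexI[of _ "-1"]) auto
    qed
    moreover have "near_orbit (y t) (2000 * \<delta>)" if "t \<in> {0..L}" for t
    proof -
      have "z \<le> z0 * exp (- t)" unfolding expL[symmetric] using that z0p by simp
      moreover have "z0 * exp (- t) \<le> 1 * 1" using that z0 by (intro mult_mono) auto
      ultimately have "near_orbit (relay_arc d (z0 * exp (- t))) (2000 * \<delta>)"
        using z by (intro near_orbit_arc[OF d]) auto
      moreover have "\<And>k. k \<in> {1..4} \<Longrightarrow> y t k = relay_arc d (z0 * exp (- t)) k"
        using flow[of t] that by simp
      ultimately show ?thesis unfolding near_orbit_def by simp
    qed
    ultimately show ?thesis using L by blast
  qed
  have pos_start: "\<exists>s\<ge>0. near_section (y s) (10^10 * e) \<and> (\<forall>t\<in>{0..s}. near_orbit (y t) (10^10 * e))"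
    if traj: "trajectory y" and r0: "0 \<le> readout 0 (y 0)" and near: "near_orbit (y 0) e" for y
  proof -
    have "\<exists>z0. q \<le> z0 \<and> z0 \<le> 1 \<and> (\<forall>k\<in>{1..4}. \<bar>y 0 k - relay_arc (\<lambda>_. 0) z0 k\<bar> \<le> 1500 * e)"
    proof -
      obtain \<sigma> where \<sigma>: "\<sigma> \<in> {-1, 1}"
        and "\<exists>z\<in>{q..1}. \<forall>k\<in>{1..4}. \<bar>\<sigma> * y 0 k - relay_arc (\<lambda>_. 0) z k\<bar> \<le> e"
        using near unfolding near_orbit_def by (rule bexE)
      then obtain z where z: "q \<le> z" "z \<le> 1"
        and b: "\<And>k. k \<in> {1..4} \<Longrightarrow> \<bar>\<sigma> * y 0 k - relay_arc (\<lambda>_. 0) z k\<bar> \<le> e"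
        by (meson atLeastAtMost_iff)
      show ?thesis
      proof (cases "\<sigma> = 1")
        case True
        have "\<bar>y 0 k - relay_arc (\<lambda>_. 0) z k\<bar> \<le> 1500 * e" if "k \<in> {1..4}" for k
          using b[OF that] True e by simp
        then show ?thesis using z by blast
      next
        case False
        then have \<sigma>: "\<sigma> = -1" using \<sigma> by simp
        have b': "\<bar>relay_arc (\<lambda>_. 0) z k + y 0 k\<bar> \<le> e" if "k \<in> {1..4}" for k
          using b[OF that] \<sigma> by simp
        have "readout 0 (relay_arc (\<lambda>_. 0) z) + readout 0 (y 0) \<le> 2 * e"
          using b'[of 1] b'[of 2] b'[of 3] b'[of 4] unfolding readout_0 by simp argo
        moreover have "29/1000 * ((1 - z) * (z - q)) \<le> readout 0 (relay_arc (\<lambda>_. 0) z)"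
          by (rule readout_arc_0_lower[OF z])
        ultimately have prod: "(1 - z) * (z - q) \<le> 70 * e" using r0 e by argo
        \<comment> \<open>The interval from \<open>q\<close> to 1 is longer than 3/4, so one factor
          is at least 3/8 and the other at most 70 e / (3/8) < 187 e.\<close>
        have "1 - z \<le> 187 * e \<or> z - q \<le> 187 * e"
        proof (cases "3/8 \<le> 1 - z")
          case True
          then have "3/8 * (z - q) \<le> (1 - z) * (z - q)" using z by (intro mult_right_mono) auto
          then show ?thesis using prod e by argo
        next
          case False
          then have "(1 - z) * (3/8) \<le> (1 - z) * (z - q)" using z q_bounds by (intro mult_left_mono) auto
          then show ?thesis using prod e by argo
        qed
        then obtain z0 w where w: "z0 \<in> {q, 1}" "w \<in> {q, 1}" "\<bar>z - w\<bar> \<le> 187 * e"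
          "\<And>k. k \<in> {1..4} \<Longrightarrow> relay_arc (\<lambda>_. 0) w k = - relay_arc (\<lambda>_. 0) z0 k"
        proof
          assume "1 - z \<le> 187 * e"
          then show ?thesis using that[of q 1] z arc_q by auto
        next
          assume "z - q \<le> 187 * e"
          then show ?thesis using that[of 1 q] z arc_q by auto
        qed
        have "\<bar>y 0 k - relay_arc (\<lambda>_. 0) z0 k\<bar> \<le> 1500 * e" if k: "k \<in> {1..4}" for k
        proof -
          have "\<bar>relay_arc (\<lambda>_. 0) z k - relay_arc (\<lambda>_. 0) w k\<bar> \<le> 8 * \<bar>z - w\<bar>"
            using k z w(2) q_bounds by (intro arc_diff) auto
          then show ?thesis using b'[OF k] w(3) w(4)[OF k] e by argo
        qed
        then show ?thesis using w(1) q_bounds by (intro exI[of _ z0]) auto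
      qed
    qed
    then obtain z0 where z0: "q \<le> z0" "z0 \<le> 1" and b: "\<And>k. k \<in> {1..4} \<Longrightarrow> \<bar>y 0 k - relay_arc (\<lambda>_. 0) z0 k\<bar> \<le> 1500 * e"
      by blast
    have "\<exists>s\<ge>0. near_section (y s) (5000 * (500000 * e)) \<and> (\<forall>t\<in>{0..s}. near_orbit (y t) (2000 * (500000 * e)))"
      by (rule wlog[OF traj r0 z0]) (use e b in auto)
    then obtain s where s: "s \<ge> 0" "near_section (y s) (5000 * (500000 * e))"
      "\<And>t. t \<in> {0..s} \<Longrightarrow> near_orbit (y t) (2000 * (500000 * e))" by blast
    have "5000 * (500000 * e) \<le> 10^10 * e" "2000 * (500000 * e) \<le> 10^10 * e" using e by simp_all
    then show ?thesis using s near_section_mono near_orbit_mono by blast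
  qed
  show ?thesis
  proof (cases "0 \<le> readout 0 (y 0)")
    case True
    then show ?thesis using pos_start[OF traj] near by blast
  next
    case False
    then have "0 \<le> readout 0 (\<lambda>k. - y 0 k)" unfolding readout_uminus by linarith
    then show ?thesis
      using pos_start[OF trajectory_uminus[OF traj]] near
      by (simp only: near_orbit_uminus near_section_uminus)
  qed
qed

text \<open>Two inductions use the two time bounds: the minimal duration of a half return makes
  finitely many of them cover any \<open>t\<close>, and the maximal duration guarantees
  \<open>n\<close> contractions by time n ln 10.\<close>

lemma geometric_decay_from_section:
  assumes traj: "trajectory y" and s: "0 \<le> s" and \<rho>: "0 < \<rho>" "\<rho> \<le> 1/600000"
    and sec: "near_section (y s) \<rho>" and t: "s + real n * ln 10 \<le> t"
  shows "near_orbit (y t) (6000 * ((9/10) ^ n * \<rho>))"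
proof -
  define h :: real where "h = ln (5/3)"
  have h: "h > 0" by (simp add: h_def)
  have base: "near_orbit (y t) (6000 * \<rho>)"
    if "0 \<le> s" "0 < \<rho>" "\<rho> \<le> 1/600000" "near_section (y s) \<rho>" "s \<le> t" "t \<le> s + real m * h" for m s \<rho> t
    using that
  proof (induction m arbitrary: s \<rho>)
    case 0
    obtain s' where s': "s + h \<le> s'" "\<And>t. t \<in> {s..s'} \<Longrightarrow> near_orbit (y t) (6000 * \<rho>)"
      using half_return[OF traj 0(1-4)] unfolding h_def by blast
    then show ?case using 0 h by simp
  next
    case (Suc m)
    obtain s' where s': "s + h \<le> s'" "near_section (y s') (9/10 * \<rho>)" "\<And>t. t \<in> {s..s'} \<Longrightarrow> near_orbit (y t) (6000 * \<rho>)"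
      using half_return[OF traj Suc.prems(1-4)] unfolding h_def by blast
    show ?case
    proof (cases "t \<le> s'")
      case True
      then show ?thesis using s'(3)[of t] Suc.prems by simp
    next
      case False
      have "near_orbit (y t) (6000 * (9/10 * \<rho>))"
        by (rule Suc.IH[of s']) (use s' Suc.prems False h in \<open>auto simp: algebra_simps\<close>)
      then show ?thesis by (rule near_orbit_mono) (use Suc.prems in auto)
    qed
  qed
  show ?thesis
    using s \<rho> sec t
  proof (induction n arbitrary: s \<rho>)
    case 0
    obtain m where "(t - s) / h < real m" using reals_Archimedean2 by blast
    then have "t \<le> s + real m * h" using h by (simp add: field_simps)
    then show ?case using base[of s \<rho> t m] 0 by simp
  next
    case (Suc n)
    obtain s' where s': "s + h \<le> s'" "s' \<le> s + ln 10" "near_section (y s') (9/10 * \<rho>)"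
      using half_return[OF traj Suc.prems(1-4)] unfolding h_def by blast
    have "near_orbit (y t) (6000 * ((9/10) ^ n * (9/10 * \<rho>)))"
      by (rule Suc.IH[of s']) (use s' Suc.prems h in \<open>auto simp: algebra_simps\<close>)
    then show ?case by (simp add: mult_ac)
  qed
qed

lemma trajectory_stability:
  assumes traj: "trajectory y" and e: "0 < e" "e \<le> 1 / 10^16" and near: "near_orbit (y 0) e"
  shows "0 \<le> t \<Longrightarrow> near_orbit (y t) (10^14 * e)"
    and "0 < e' \<Longrightarrow> \<exists>T. \<forall>t\<ge>T. near_orbit (y t) e'"
proof -
  obtain s where s: "0 \<le> s" "near_section (y s) (10^10 * e)" "\<And>t. t \<in> {0..s} \<Longrightarrow> near_orbit (y t) (10^10 * e)"
    using reach_section[OF traj e(1) _ near] e by auto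
  have decay: "near_orbit (y t) (6000 * ((9/10) ^ n * (10^10 * e)))" if "s + real n * ln 10 \<le> t" for n t
    by (rule geometric_decay_from_section[OF traj s(1) _ _ s(2) that]) (use e in auto)
  show "near_orbit (y t) (10^14 * e)" if "0 \<le> t"
  proof (cases "t \<le> s")
    case True
    then show ?thesis using near_orbit_mono[OF s(3)[of t]] that e by simp
  next
    case False
    then show ?thesis using near_orbit_mono[OF decay[of 0 t]] e by simp
  qed
  show "\<exists>T. \<forall>t\<ge>T. near_orbit (y t) e'" if "0 < e'"
  proof -
    have "0 < e' / (6000 * (10^10 * e))" using that e by simp
    then obtain n where "(9/10) ^ n < e' / (6000 * (10^10 * e))"
      using real_arch_pow_inv[of "e' / (6000 * (10^10 * e))" "9/10"] by auto
    then have "6000 * ((9/10) ^ n * (10^10 * e)) \<le> e'" using e by (simp add: field_simps)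
    then show ?thesis using near_orbit_mono[OF decay[of n]] by blast
  qed
qed

subsection \<open>Modes of Filippov solutions\<close>

text \<open>
  Mode \<open>k\<close> applies the operator \<open>(D + 1) (D + 2) (D + 3) (D + 4)\<close> without its factor \<open>D + k\<close> to \<open>\<phi>\<close>,
  so that \<open>y\<^sub>k' + k y\<^sub>k = - sign \<phi>\<close>.
\<close>

definition mode :: "(nat \<Rightarrow> real) \<Rightarrow> nat \<Rightarrow> real" where
  "mode x k =
     (if k = 1 then x 3 + 9 * x 2 + 26 * x 1 + 24 * x 0
      else if k = 2 then x 3 + 8 * x 2 + 19 * x 1 + 12 * x 0
      else if k = 3 then x 3 + 7 * x 2 + 14 * x 1 + 8 * x 0
      else x 3 + 6 * x 2 + 11 * x 1 + 6 * x 0)"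

lemma mode_simps:
  "mode x 1 = x 3 + 9 * x 2 + 26 * x 1 + 24 * x 0" "mode x 2 = x 3 + 8 * x 2 + 19 * x 1 + 12 * x 0"
  "mode x 3 = x 3 + 7 * x 2 + 14 * x 1 + 8 * x 0" "mode x 4 = x 3 + 6 * x 2 + 11 * x 1 + 6 * x 0"
  by (simp_all add: mode_def)

lemma readout_mode: "j < 4 \<Longrightarrow> readout j (mode x) = x j"
proof -
  assume "j < 4"
  then have "j = 0 \<or> j = 1 \<or> j = 2 \<or> j = 3" by auto
  then show ?thesis unfolding readout_def mode_simps by (elim disjE) (simp_all add: field_simps)
qed

lemma mode_readout: "k \<in> {1..4} \<Longrightarrow> mode (\<lambda>j. readout j v) k = v k"
proof -
  assume "k \<in> {1..4}"
  then have "k = 1 \<or> k = 2 \<or> k = 3 \<or> k = 4" by auto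
  then show ?thesis unfolding readout_def by (elim disjE) (simp_all only: mode_simps, simp_all add: field_simps)
qed

lemma nth_deriv_on_0 [simp]: "nth_deriv_on J 0 f = f"
  by (simp add: nth_deriv_on_def)

lemma nth_deriv_on_Suc: "nth_deriv_on J (Suc k) f = (\<lambda>s. vector_derivative (nth_deriv_on J k f) (at s within J))"
  by (simp add: nth_deriv_on_def)

lemma C_k_on_has_derivative:
  assumes "C_k_on n f J" "j < n" "s \<in> J"
  shows "(nth_deriv_on J j f has_real_derivative nth_deriv_on J (Suc j) f s) (at s within J)"
  using assms unfolding C_k_on_def differentiable_on_def nth_deriv_on_Suc
  by (simp add: has_real_derivative_iff_has_vector_derivative vector_derivative_works[symmetric])

text \<open>A constant sign of \<phi> makes \<open>Sgn\<close> a singleton, so the inclusion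
  determines the fourth derivative almost everywhere as a continuous function. Endpoints are
  included because \<phi> may vanish there and the pieces must be joined.\<close>

lemma filippov_derivative_3:
  assumes f: "filippov_solution_on {0..} \<psi>" and \<sigma>: "\<sigma> \<in> {-1, 1}" and a: "0 \<le> a"
    and sign: "\<And>s. a < s \<Longrightarrow> s < b \<Longrightarrow> 0 < \<sigma> * \<psi> s" and s: "s \<in> {a..b}"
  shows "(nth_deriv_on {0..} 3 \<psi> has_real_derivative
      - \<sigma> - 10 * nth_deriv_on {0..} 3 \<psi> s - 35 * nth_deriv_on {0..} 2 \<psi> s
        - 50 * nth_deriv_on {0..} 1 \<psi> s - 24 * \<psi> s) (at s within {a..b})"
proof -
  define D where "D j = nth_deriv_on {0..} j \<psi>" for j
  define h where "h s = - \<sigma> - 10 * D 3 s - 35 * D 2 s - 50 * D 1 s - 24 * D 0 s" for s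
  have C3: "C_k_on 3 \<psi> {0..}" and ac: "locally_abs_continuous_on {0..} (D 3)"
    and ae: "AE s in lebesgue. s \<in> {0..} \<longrightarrow> D 3 differentiable (at s within {0..}) \<and>
        - (D 4 s + 10 * D 3 s + 35 * D 2 s + 50 * D 1 s + 24 * \<psi> s) \<in> Sgn (\<psi> s)"
    using f unfolding filippov_solution_on_def D_def by blast+
  have "continuous_on {0..} (D j)" if "j \<le> 3" for j
    using C3 that unfolding C_k_on_def D_def
    by (metis differentiable_imp_continuous_on order_le_less)
  then have "continuous_on {a..b} (D j)" if "j \<le> 3" for j
    by (rule continuous_on_subset) (use a that in auto)
  then have cont: "continuous_on {a..b} h"
    unfolding h_def by (intro continuous_intros) simp_all
  define P where "P s \<longleftrightarrow> D 3 differentiable (at s within {0..}) \<and>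
      - (D 4 s + 10 * D 3 s + 35 * D 2 s + 50 * D 1 s + 24 * \<psi> s) \<in> Sgn (\<psi> s)" for s
  have "AE s in lebesgue. s \<in> {0..} \<longrightarrow> P s"
    using ae unfolding P_def .
  then obtain N where N: "N \<in> null_sets lebesgue" "{s \<in> space lebesgue. \<not> (s \<in> {0..} \<longrightarrow> P s)} \<subseteq> N"
    unfolding eventually_ae_filter by blast
  have "(D 3 has_real_derivative h s) (at s within {a..b})"
  proof (rule abs_continuous_derivative_ae[OF _ _ _ _ cont s])
    show "abs_continuous_on {a..b} (D 3)"
      using ac a unfolding locally_abs_continuous_on_def by auto
    show "a \<le> b" using s by simp
    show "negligible N" using N(1) by (simp add: negligible_iff_null_sets)
    fix x assume x: "x \<in> {a<..<b} - N"
    then have x0: "0 < x" using a by auto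
    have "x \<notin> {s \<in> space lebesgue. \<not> (s \<in> {0..} \<longrightarrow> P s)}" using N(2) x by blast
    then have "P x" using x0 by simp
    then have "D 3 differentiable (at x within {0..})"
      and eq: "- (D 4 x + 10 * D 3 x + 35 * D 2 x + 50 * D 1 x + 24 * \<psi> x) \<in> Sgn (\<psi> x)"
      unfolding P_def by blast+
    then have "(D 3 has_real_derivative D 4 x) (at x within {0..})"
      unfolding D_def by (simp add: has_real_derivative_iff_has_vector_derivative vector_derivative_works[symmetric]
          nth_deriv_on_Suc[of _ 3, simplified])
    moreover have "at x within {0..} = at x"
      using x0 by (intro at_within_interior) (simp add: interior_real_atLeast)
    moreover have "Sgn (\<psi> x) = {\<sigma>}"
      using sign[of x] x \<sigma> by (auto simp: Sgn_def sgn_if zero_less_mult_iff)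
    then have "D 4 x = h x" using eq unfolding h_def D_def by simp
    ultimately show "(D 3 has_real_derivative h x) (at x)" by simp
  qed
  then show ?thesis unfolding D_def h_def by simp
qed

lemma filippov_trajectory:
  assumes f: "filippov_solution_on {0..} \<psi>"
  shows "trajectory (\<lambda>s. mode (\<lambda>j. nth_deriv_on {0..} j \<psi> s))"
proof -
  define D where "D j = nth_deriv_on {0..} j \<psi>" for j
  have C3: "C_k_on 3 \<psi> {0..}" using f unfolding filippov_solution_on_def by blast
  have D: "(D j has_real_derivative D (Suc j) s) (at s within {0..})" if "j < 3" "0 \<le> s" for j s
    using C_k_on_has_derivative[OF C3 that(1)] that(2) unfolding D_def by simp
  have r: "readout 0 (mode x) = x 0" "readout 1 (mode x) = x 1" for x by (simp_all add: readout_mode)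
  have flow: "\<sigma> * mode (\<lambda>j. D j s) k = - 1 / real k + (\<sigma> * mode (\<lambda>j. D j a) k + 1 / real k) * exp (- (real k * (s - a)))"
    if \<sigma>: "\<sigma> \<in> {-1, 1}" and a: "0 \<le> a" and sign: "\<forall>s\<in>{a<..<b}. 0 < \<sigma> * D 0 s" and s: "s \<in> {a..b}" and k: "k \<in> {1..4}"
    for \<sigma> a b s k
  proof -
    have k': "k = 1 \<or> k = 2 \<or> k = 3 \<or> k = 4" using k by auto
    have D3: "(D 3 has_real_derivative - \<sigma> - 10 * D 3 t - 35 * D 2 t - 50 * D 1 t - 24 * D 0 t) (at t within {a..b})"
      if "t \<in> {a..b}" for t
      using filippov_derivative_3[OF f \<sigma> a _ that] sign unfolding D_def by simp
    have Dj: "(D 0 has_real_derivative D 1 t) (at t within {a..b})" "(D 1 has_real_derivative D 2 t) (at t within {a..b})"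
      "(D 2 has_real_derivative D 3 t) (at t within {a..b})" if "t \<in> {a..b}" for t
      using D[of 0 t] D[of 1 t] D[of 2 t] that a
      by (auto simp: numeral_2_eq_2 numeral_3_eq_3 intro: DERIV_subset)
    have mode_deriv: "((\<lambda>t. mode (\<lambda>j. D j t) k) has_real_derivative - \<sigma> - real k * mode (\<lambda>j. D j t) k) (at t within {a..b})"
      if t: "t \<in> {a..b}" for t
      using k' by (elim disjE; simp only: mode_simps; auto intro!: derivative_eq_intros D3[OF t] Dj[OF t] simp: algebra_simps simp del: One_nat_def)
    \<comment> \<open>Multiplying by the integrating factor exp (k t) gives a constant
      function.\<close>
    define g where "g t = (\<sigma> * mode (\<lambda>j. D j t) k + 1 / real k) * exp (real k * t)" for t
    have "\<sigma> * \<sigma> = 1" "real k * (1 / real k) = 1" using \<sigma> k by auto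
    then have cancel: "\<sigma> * (- \<sigma> - real k * m) * E + (\<sigma> * m + 1 / real k) * (real k * E) = 0" for m E
      by algebra
    have "(g has_real_derivative 0) (at t within {a..b})" if "t \<in> {a..b}" for t
    proof -
      have "(g has_real_derivative (\<sigma> * (- \<sigma> - real k * mode (\<lambda>j. D j t) k)) * exp (real k * t)
          + (\<sigma> * mode (\<lambda>j. D j t) k + 1 / real k) * (real k * exp (real k * t))) (at t within {a..b})"
        unfolding g_def by (auto intro!: derivative_eq_intros mode_deriv[OF that])
      then show ?thesis unfolding cancel .
    qed
    then obtain c where c: "\<And>t. t \<in> {a..b} \<Longrightarrow> g t = c"
      using has_field_derivative_zero_constant[of "{a..b}" g] by auto
    have "g s = g a" using c[of s] c[of a] s by simp
    then have "(\<sigma> * mode (\<lambda>j. D j s) k + 1 / real k) = (\<sigma> * mode (\<lambda>j. D j a) k + 1 / real k) * (exp (real k * a) / exp (real k * s))"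
      unfolding g_def by (simp add: field_simps)
    also have "exp (real k * a) / exp (real k * s) = exp (- (real k * (s - a)))"
      by (simp add: exp_diff[symmetric] algebra_simps)
    finally show ?thesis by argo
  qed
  show ?thesis
    unfolding trajectory_def r D_def[symmetric]
  proof (intro conjI allI impI ballI)
    show "((\<lambda>s. D 0 s) has_real_derivative D 1 s) (at s within {0..})" if "0 \<le> s" for s
      using D[of 0 s] that by simp
  qed (rule flow)
qed

subsection \<open>The periodic solution\<close>

definition half_period :: real where
  "half_period = - ln q"

lemma half_period_pos: "0 < half_period"
  and exp_half_period: "exp (- half_period) = q"
  using q_bounds by (simp_all add: half_period_def)

definition cell :: "int \<Rightarrow> real set" where
  "cell n = {of_int n * half_period..of_int (n + 1) * half_period}"

definition parity_sign :: "int \<Rightarrow> real" where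
  "parity_sign n = (if even n then 1 else - 1)"

definition cycle :: "real \<Rightarrow> nat \<Rightarrow> real" where
  "cycle s = (let n = \<lfloor>s / half_period\<rfloor> in
     (\<lambda>k. parity_sign n * relay_arc (\<lambda>_. 0) (exp (- (s - of_int n * half_period))) k))"

lemma parity_sign_simps: "parity_sign (n + 1) = - parity_sign n" "parity_sign (1 + n) = - parity_sign n" "parity_sign n * parity_sign n = 1"
    "\<bar>parity_sign n\<bar> = 1" "parity_sign n \<in> {-1, 1}"
  by (auto simp: parity_sign_def)

lemma floor_cell: "s \<in> cell \<lfloor>s / half_period\<rfloor>"
  using floor_divide_lower[OF half_period_pos, of s] floor_divide_upper[OF half_period_pos, of s]
  by (simp add: cell_def)

lemma readout_scale: "readout j (\<lambda>k. c * v k) = c * readout j v"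
  unfolding readout_def by (simp add: algebra_simps)

text \<open>Cells are closed and share endpoints. At the right end the floor is already n + 1, and
  the two formulas agree by the antisymmetry \<open>arc_q\<close>.\<close>

lemma cycle_cell:
  assumes s: "s \<in> cell n" and k: "k \<in> {1..4}"
  shows "cycle s k = parity_sign n * relay_arc (\<lambda>_. 0) (exp (- (s - of_int n * half_period))) k"
proof (cases "s = of_int (n + 1) * half_period")
  case True
  then have "\<lfloor>s / half_period\<rfloor> = n + 1" using half_period_pos by simp
  then show ?thesis using True k
    by (simp add: cycle_def Let_def parity_sign_simps algebra_simps exp_half_period arc_q)
next
  case False
  then have "\<lfloor>s / half_period\<rfloor> = n"
    using s half_period_pos unfolding cell_def
    by (intro floor_unique) (auto simp: pos_le_divide_eq pos_divide_less_eq)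
  then show ?thesis by (simp add: cycle_def)
qed

lemma readout_cycle_cell:
  assumes "s \<in> cell n"
  shows "readout j (cycle s) = parity_sign n * readout j (relay_arc (\<lambda>_. 0) (exp (- (s - of_int n * half_period))))"
  using readout_cong[OF cycle_cell[OF assms]] by (simp add: readout_scale)

lemma cell_phase:
  assumes "s \<in> cell n"
  shows "exp (- (s - of_int n * half_period)) \<in> {q..1}"
  using assms unfolding exp_half_period[symmetric] cell_def by (simp add: algebra_simps)

text \<open>The subtracted constant is the response to the relay term -1. It is a moment of the
  partial fraction coefficients: 0 for j < 3 and 1 for j = 3, so the relay enters only the fourth
  derivative.\<close>

lemma readout_arc_has_derivative:
  "((\<lambda>t. readout j (relay_arc (\<lambda>_. 0) (exp (- t)))) has_real_derivative
      readout (Suc j) (relay_arc (\<lambda>_. 0) (exp (- t))) - ((-1)^j - 3 * (-2)^j + 3 * (-3)^j - (-4)^j) / 6) (at t)"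
proof -
  have exp_pow: "exp (- t) ^ k = exp (- (real k * t))" for t k
    by (simp add: exp_of_nat_mult[symmetric])
  have D: "((\<lambda>t. relay_arc (\<lambda>_. 0) (exp (- t)) k) has_real_derivative - real k * relay_arc (\<lambda>_. 0) (exp (- t)) k - 1) (at t)"
    if "k > 0" for k
    unfolding relay_arc_def exp_pow using that
    by (auto intro!: derivative_eq_intros simp: field_simps)
  show ?thesis
    unfolding readout_def
    by (auto intro!: derivative_eq_intros D simp: field_simps simp del: One_nat_def)
qed

text \<open>At a common endpoint the one-sided derivatives from the two cells coincide, and the
  union of the cells is a neighbourhood.\<close>

lemma has_real_derivative_cells:
  assumes "\<And>n s. s \<in> cell n \<Longrightarrow> (f has_real_derivative f' s) (at s within cell n)"
  shows "(f has_real_derivative f' s) (at s)"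
proof -
  define n where "n = \<lfloor>s / half_period\<rfloor>"
  have s: "s \<in> cell n" unfolding n_def by (rule floor_cell)
  have h: "half_period > 0" by (rule half_period_pos)
  have lt: "s < of_int (n + 1) * half_period"
    using floor_divide_upper[OF h, of s] by (simp add: n_def)
  show ?thesis
  proof (cases "s = of_int n * half_period")
    case True
    then have s': "s \<in> cell (n - 1)" using h by (simp add: cell_def algebra_simps)
    have "((\<lambda>y. (f y - f s) / (y - s)) \<longlongrightarrow> f' s) (sup (at s within cell (n - 1)) (at s within cell n))"
      using assms[OF s] assms[OF s'] unfolding has_field_derivative_iff by (rule filterlim_sup[rotated])
    moreover have "cell (n - 1) \<union> cell n = {of_int (n - 1) * half_period..of_int (n + 1) * half_period}"
      using h by (auto simp: cell_def algebra_simps)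
    moreover have "s \<in> interior {of_int (n - 1) * half_period..of_int (n + 1) * half_period}"
      using True h by (simp add: algebra_simps)
    ultimately show ?thesis
      unfolding has_field_derivative_iff at_within_union[symmetric] by (simp only: at_within_interior)
  next
    case False
    then have "s \<in> interior (cell n)" using s lt by (simp add: cell_def)
    then show ?thesis using assms[OF s] by (metis at_within_interior)
  qed
qed

lemma readout_cycle_has_derivative_cell:
  assumes s: "s \<in> cell n"
  shows "(readout j \<circ> cycle has_real_derivative readout (Suc j) (cycle s)
      - parity_sign n * (((-1)^j - 3 * (-2)^j + 3 * (-3)^j - (-4)^j) / 6)) (at s within cell n)"
proof -
  let ?c = "((-1)^j - 3 * (-2)^j + 3 * (-3)^j - (-4)^j) / 6 :: real"
  let ?g = "\<lambda>s. parity_sign n * readout j (relay_arc (\<lambda>_. 0) (exp (- (s - of_int n * half_period))))"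
  have "((\<lambda>t. readout j (relay_arc (\<lambda>_. 0) (exp (- (t - of_int n * half_period))))) has_real_derivative
      readout (Suc j) (relay_arc (\<lambda>_. 0) (exp (- (s - of_int n * half_period)))) - ?c) (at s)"
    using DERIV_shift[of "\<lambda>t. readout j (relay_arc (\<lambda>_. 0) (exp (- t)))" _ s "- (of_int n * half_period)"]
      readout_arc_has_derivative[of j "s - of_int n * half_period"] by simp
  then have "(?g has_real_derivative parity_sign n *
      (readout (Suc j) (relay_arc (\<lambda>_. 0) (exp (- (s - of_int n * half_period)))) - ?c)) (at s within cell n)"
    by (rule has_field_derivative_at_within[OF DERIV_cmult])
  then have "(?g has_real_derivative readout (Suc j) (cycle s) - parity_sign n * ?c) (at s within cell n)"
    unfolding readout_cycle_cell[OF s] by (simp only: right_diff_distrib)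
  then show ?thesis
    by (rule has_field_derivative_transform_within[OF _ zero_less_one s])
       (simp add: readout_cycle_cell)
qed

lemma readout_cycle_has_derivative:
  assumes "j < 3"
  shows "(readout j \<circ> cycle has_real_derivative readout (Suc j) (cycle s)) (at s)"
proof (rule has_real_derivative_cells)
  fix n s assume s: "s \<in> cell n"
  have "j = 0 \<or> j = 1 \<or> j = 2" using assms by auto
  then have "((-1)^j - 3 * (-2)^j + 3 * (-3)^j - (-4)^j) / 6 = (0::real)" by (elim disjE) simp_all
  then show "(readout j \<circ> cycle has_real_derivative readout (Suc j) (cycle s)) (at s within cell n)"
    using readout_cycle_has_derivative_cell[OF s, of j] by simp
qed

lemma nth_deriv_cycle: "j \<le> 3 \<Longrightarrow> nth_deriv_on UNIV j (readout 0 \<circ> cycle) = readout j \<circ> cycle"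
proof (induction j)
  case (Suc j)
  have IH: "nth_deriv_on UNIV j (readout 0 \<circ> cycle) = readout j \<circ> cycle"
    by (rule Suc.IH) (use Suc.prems in simp)
  have "vector_derivative (readout j \<circ> cycle) (at s) = readout (Suc j) (cycle s)" for s
    using readout_cycle_has_derivative[of j s] Suc.prems
    by (intro vector_derivative_at) (simp add: has_real_derivative_iff_has_vector_derivative)
  then show ?case unfolding nth_deriv_on_Suc IH by (simp add: comp_def)
qed simp

lemma readout_bound:
  assumes "\<And>k. k \<in> {1..4} \<Longrightarrow> \<bar>v k\<bar> \<le> e" "j \<le> 4"
  shows "\<bar>readout j v\<bar> \<le> 300 * e"
proof -
  have b: "\<bar>v 1\<bar> \<le> e" "\<bar>v 2\<bar> \<le> e" "\<bar>v 3\<bar> \<le> e" "\<bar>v 4\<bar> \<le> e" using assms(1) by simp_all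
  have "j = 0 \<or> j = 1 \<or> j = 2 \<or> j = 3 \<or> j = 4" using assms(2) by auto
  then have "\<bar>(-1)^j * v 1\<bar> \<le> e" "\<bar>(-2)^j * v 2\<bar> \<le> 16 * e" "\<bar>(-3)^j * v 3\<bar> \<le> 81 * e" "\<bar>(-4)^j * v 4\<bar> \<le> 256 * e"
    using b by (auto simp: abs_mult)
  then show ?thesis unfolding readout_def by argo
qed

lemma readout_diff: "readout j v - readout j w = readout j (\<lambda>k. v k - w k)"
  unfolding readout_def by (simp add: field_simps)

lemma cycle_bound: "k \<in> {1..4} \<Longrightarrow> \<bar>cycle s k\<bar> \<le> 3"
proof -
  assume k: "k \<in> {1..4}"
  define x where "x = exp (- (s - of_int \<lfloor>s / half_period\<rfloor> * half_period))"
  have x: "0 \<le> x" "x \<le> 1" using cell_phase[OF floor_cell] q_bounds unfolding x_def by auto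
  have "amp k * x ^ k \<le> 2 * 1"
    using x k amp_le_2[of k] by (intro mult_mono power_le_one) auto
  moreover have "0 \<le> amp k * x ^ k" using x amp_le_2(1)[of k] by simp
  moreover have "0 \<le> 1 / real k" "1 / real k \<le> 1" using k by auto
  ultimately have "\<bar>amp k * x ^ k - 1 / real k\<bar> \<le> 3" by argo
  then have "\<bar>relay_arc (\<lambda>_. 0) x k\<bar> \<le> 3" by (simp add: relay_arc_def)
  then show ?thesis using cycle_cell[OF floor_cell k, of s]
    by (simp add: abs_mult parity_sign_simps x_def)
qed

text \<open>The derivative of \<open>readout 3\<close> jumps at switchings, so the mean value bound
  (at most 900 + 1) is applied in each cell and chained across shared endpoints.\<close>

lemma readout_3_cycle_lipschitz: "\<bar>readout 3 (cycle x) - readout 3 (cycle y)\<bar> \<le> 1000 * \<bar>x - y\<bar>"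
proof -
  define f where "f = readout 3 \<circ> cycle"
  have cell: "\<bar>f x - f y\<bar> \<le> 1000 * \<bar>x - y\<bar>" if "x \<in> cell n" "y \<in> cell n" for x y n
  proof -
    have "norm (f x - f y) \<le> 1000 * norm (x - y)"
    proof (rule field_differentiable_bound)
      show "convex (cell n)" by (simp add: cell_def)
      fix s assume s: "s \<in> cell n"
      show "(f has_real_derivative readout 4 (cycle s) - parity_sign n) (at s within cell n)"
        using readout_cycle_has_derivative_cell[OF s, of 3] unfolding f_def by simp
      have "\<bar>readout 4 (cycle s)\<bar> \<le> 300 * 3" by (rule readout_bound[OF cycle_bound]) auto
      then show "norm (readout 4 (cycle s) - parity_sign n) \<le> 1000"
        using parity_sign_simps(4)[of n] unfolding real_norm_def by argo
    qed (use that in auto)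
    then show ?thesis by simp
  qed
  have chain: "\<bar>f x - f y\<bar> \<le> 1000 * (y - x)" if "x \<in> cell n" "y \<in> cell (n + int m)" "x \<le> y" for x y n m
    using that(2,3)
  proof (induction m arbitrary: y)
    case 0
    then show ?case using cell[of x n y] that(1) by simp
  next
    case (Suc m)
    define w where "w = of_int (n + int m + 1) * half_period"
    have h: "half_period > 0" by (rule half_period_pos)
    have w: "w \<in> cell (n + int m)" "w \<in> cell (n + int (Suc m))" "w \<le> y"
      using h Suc.prems(1) by (auto simp: w_def cell_def algebra_simps)
    have "x \<le> of_int (n + 1) * half_period" using that(1) by (simp add: cell_def)
    also have "\<dots> \<le> w" unfolding w_def using h by (intro mult_right_mono) auto
    finally have xw: "x \<le> w" .
    have "\<bar>f x - f w\<bar> \<le> 1000 * (w - x)" by (rule Suc.IH[OF w(1) xw])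
    moreover have "\<bar>f w - f y\<bar> \<le> 1000 * (y - w)" using cell[OF w(2) Suc.prems(1)] w(3) by simp
    ultimately show ?case by argo
  qed
  have le: "\<bar>f x - f y\<bar> \<le> 1000 * (y - x)" if "x \<le> y" for x y
  proof -
    have "\<lfloor>x / half_period\<rfloor> \<le> \<lfloor>y / half_period\<rfloor>"
      using that half_period_pos by (intro floor_mono divide_right_mono) auto
    then obtain m where "\<lfloor>y / half_period\<rfloor> = \<lfloor>x / half_period\<rfloor> + int m"
      using zle_iff_zadd by blast
    then show ?thesis using chain[OF floor_cell _ that] floor_cell[of y] by metis
  qed
  show ?thesis
  proof (cases "x \<le> y")
    case True
    then show ?thesis using le[OF True] by (simp add: f_def)
  next
    case False
    then show ?thesis using le[of y x] by (simp add: f_def abs_minus_commute)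
  qed
qed

lemma lipschitz_imp_abs_continuous_on:
  assumes "\<And>x y. \<bar>f x - f y\<bar> \<le> M * \<bar>x - y\<bar>" "0 < M"
  shows "abs_continuous_on I f"
  unfolding abs_continuous_on_def
proof (intro allI impI)
  fix e :: real assume e: "0 < e"
  show "\<exists>d>0. \<forall>\<D> S. \<D> division_of S \<and> S \<subseteq> I \<and> (\<Sum>K\<in>\<D>. Sup K - Inf K) < d \<longrightarrow>
      (\<Sum>K\<in>\<D>. \<bar>f (Sup K) - f (Inf K)\<bar>) < e"
  proof (intro exI[of _ "e / M"] conjI allI impI)
    show "0 < e / M" using e assms(2) by simp
    fix \<D> S assume D: "\<D> division_of S \<and> S \<subseteq> I \<and> (\<Sum>K\<in>\<D>. Sup K - Inf K) < e / M"
    have "(\<Sum>K\<in>\<D>. \<bar>f (Sup K) - f (Inf K)\<bar>) \<le> (\<Sum>K\<in>\<D>. M * (Sup K - Inf K))"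
    proof (rule sum_mono)
      fix K assume K: "K \<in> \<D>"
      then obtain a b where ab: "K = cbox a b" using D by blast
      moreover have "K \<noteq> {}" using D K by blast
      ultimately have "Inf K \<le> Sup K" by auto
      then show "\<bar>f (Sup K) - f (Inf K)\<bar> \<le> M * (Sup K - Inf K)"
        using assms(1)[of "Sup K" "Inf K"] by simp
    qed
    also have "\<dots> = M * (\<Sum>K\<in>\<D>. Sup K - Inf K)" by (simp add: sum_distrib_left)
    also have "\<dots> < e" using D assms(2) by (simp add: field_simps)
    finally show "(\<Sum>K\<in>\<D>. \<bar>f (Sup K) - f (Inf K)\<bar>) < e" .
  qed
qed

text \<open>Each -k with k = 1, ..., 4 is a root of the characteristic polynomial, so the
  coefficient of every mode vanishes.\<close>

lemma readout_characteristic: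
  "readout 4 v + 10 * readout 3 v + 35 * readout 2 v + 50 * readout 1 v + 24 * readout 0 v = 0"
  unfolding readout_def by (simp add: field_simps)

text \<open>The switching times are countable, hence null. Elsewhere the time is interior to a cell,
  where \<phi> has the sign \<open>parity_sign n\<close> and the extra term in the derivative of
  \<open>readout 3\<close> is exactly the relay.\<close>

lemma filippov_cycle: "filippov_solution_on UNIV (readout 0 \<circ> cycle)"
  unfolding filippov_solution_on_def
proof (intro conjI)
  define F where "F j = readout j \<circ> cycle" for j
  have nd: "nth_deriv_on UNIV j (F 0) = F j" if "j \<le> 3" for j
    using nth_deriv_cycle[OF that] by (simp add: F_def)
  have lip: "\<bar>F 3 x - F 3 y\<bar> \<le> 1000 * \<bar>x - y\<bar>" for x y
    using readout_3_cycle_lipschitz by (simp add: F_def)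
  have "C_k_on 3 (F 0) UNIV"
    unfolding C_k_on_def
  proof (intro conjI allI impI)
    fix j :: nat assume "j < 3"
    then have "\<And>s. (F j has_real_derivative F (Suc j) s) (at s)"
      using readout_cycle_has_derivative[of j] by (simp add: F_def)
    then show "nth_deriv_on UNIV j (F 0) differentiable_on UNIV"
      using \<open>j < 3\<close> unfolding differentiable_on_def
      by (auto simp: nd real_differentiable_def)
  next
    have "1000-lipschitz_on UNIV (F 3)"
      using lip by (intro lipschitz_onI) (auto simp: dist_real_def)
    then show "continuous_on UNIV (nth_deriv_on UNIV 3 (F 0))"
      by (simp add: nd lipschitz_on_continuous_on)
  qed
  then show "C_k_on 3 (readout 0 \<circ> cycle) UNIV" by (simp add: F_def)
  show "locally_abs_continuous_on UNIV (nth_deriv_on UNIV 3 (readout 0 \<circ> cycle))"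
    using nd[of 3] lip unfolding locally_abs_continuous_on_def F_def
    by (auto intro!: lipschitz_imp_abs_continuous_on[where M = 1000])
  have ae: "AE s in lebesgue. s \<notin> range (\<lambda>n. of_int n * half_period)"
  proof (rule AE_not_in)
    have "range (\<lambda>n. of_int n * half_period) \<in> null_sets lborel"
      by (rule countable_imp_null_set_lborel) simp
    then show "range (\<lambda>n. of_int n * half_period) \<in> null_sets lebesgue"
      by (rule null_sets_completionI)
  qed
  have key: "F 3 differentiable (at s) \<and>
      - (nth_deriv_on UNIV 4 (F 0) s + 10 * F 3 s + 35 * F 2 s + 50 * F 1 s + 24 * F 0 s) \<in> Sgn (F 0 s)"
    if s: "s \<notin> range (\<lambda>n. of_int n * half_period)" for s
  proof -
    define n where "n = \<lfloor>s / half_period\<rfloor>"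
    have sn: "s \<in> cell n" unfolding n_def by (rule floor_cell)
    have ne: "s \<noteq> of_int n * half_period" "s \<noteq> of_int (n + 1) * half_period" using s by blast+
    then have int: "s \<in> interior (cell n)" using sn by (simp add: cell_def)
    have D: "(F 3 has_real_derivative F 4 s - parity_sign n) (at s)"
      using readout_cycle_has_derivative_cell[OF sn, of 3] at_within_interior[OF int]
      unfolding F_def by simp
    have nd4: "nth_deriv_on UNIV 4 (F 0) s = F 4 s - parity_sign n"
      using D nth_deriv_on_Suc[of UNIV 3 "F 0"] nd[of 3]
      by (simp add: has_real_derivative_iff_has_vector_derivative vector_derivative_at)
    have "q < exp (- (s - of_int n * half_period))" "exp (- (s - of_int n * half_period)) < 1"
      unfolding exp_half_period[symmetric] using sn ne by (auto simp: cell_def algebra_simps)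
    then have pos: "0 < readout 0 (relay_arc (\<lambda>_. 0) (exp (- (s - of_int n * half_period))))"
      by (rule readout_arc_0_pos)
    have "F 0 s = parity_sign n * readout 0 (relay_arc (\<lambda>_. 0) (exp (- (s - of_int n * half_period))))"
      unfolding F_def comp_def by (rule readout_cycle_cell[OF sn])
    then have "Sgn (F 0 s) = {parity_sign n}"
      using pos parity_sign_simps(5)[of n] by (auto simp: Sgn_def sgn_mult)
    moreover have "- (nth_deriv_on UNIV 4 (F 0) s + 10 * F 3 s + 35 * F 2 s + 50 * F 1 s + 24 * F 0 s) = parity_sign n"
      unfolding nd4 using readout_characteristic[of "cycle s"] unfolding F_def comp_def by argo
    ultimately show ?thesis using D unfolding real_differentiable_def by auto
  qed
  show "AE s in lebesgue. s \<in> UNIV \<longrightarrow> nth_deriv_on UNIV 3 (readout 0 \<circ> cycle) differentiable (at s within UNIV) \<and>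
      - (nth_deriv_on UNIV 4 (readout 0 \<circ> cycle) s + 10 * nth_deriv_on UNIV 3 (readout 0 \<circ> cycle) s
        + 35 * nth_deriv_on UNIV 2 (readout 0 \<circ> cycle) s + 50 * nth_deriv_on UNIV 1 (readout 0 \<circ> cycle) s
        + 24 * (readout 0 \<circ> cycle) s) \<in> Sgn ((readout 0 \<circ> cycle) s)"
    using ae
  proof eventually_elim
    case (elim s)
    then show ?case using key[of s] nd[of 3] nd[of 2] nd[of 1] unfolding F_def by (simp only: order_refl) simp
  qed
qed

lemma cycle_periodic: "cycle (s + 2 * half_period) = cycle s"
proof -
  have "(s + 2 * half_period) / half_period = s / half_period + of_int 2"
    using half_period_pos by (simp add: field_simps)
  then have "\<lfloor>(s + 2 * half_period) / half_period\<rfloor> = \<lfloor>s / half_period\<rfloor> + 2"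
    by (simp only: floor_add_int)
  then show ?thesis
    by (simp add: cycle_def Let_def parity_sign_def algebra_simps)
qed

section \<open>Comparison of states in R^4 with mode coordinates\<close>

definition state_vector :: "(nat \<Rightarrow> real) \<Rightarrow> real ^ 4" where
  "state_vector x = vector [x 0, x 1, x 2, x 3]"

lemma state_vector_nth:
  "state_vector x $ 1 = x 0" "state_vector x $ 2 = x 1" "state_vector x $ 3 = x 2" "state_vector x $ 4 = x 3"
  unfolding state_vector_def vector_def by simp_all

lemma dist_state_vector_le: "dist (state_vector x) (state_vector y) \<le> \<bar>x 0 - y 0\<bar> + \<bar>x 1 - y 1\<bar> + \<bar>x 2 - y 2\<bar> + \<bar>x 3 - y 3\<bar>"
  using norm_le_l1_cart[of "state_vector x - state_vector y"]
  by (simp add: dist_norm sum_4 state_vector_nth)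

lemma dist_state_vector_ge: "j < 4 \<Longrightarrow> \<bar>x j - y j\<bar> \<le> dist (state_vector x) (state_vector y)"
proof -
  assume "j < 4"
  then have "j = 0 \<or> j = 1 \<or> j = 2 \<or> j = 3" by auto
  moreover have "\<bar>state_vector x $ i - state_vector y $ i\<bar> \<le> dist (state_vector x) (state_vector y)" for i
    using component_le_norm_cart[of "state_vector x - state_vector y" i] by (simp add: dist_norm)
  from this[of 1] this[of 2] this[of 3] this[of 4]
  have "\<bar>x 0 - y 0\<bar> \<le> dist (state_vector x) (state_vector y)" "\<bar>x 1 - y 1\<bar> \<le> dist (state_vector x) (state_vector y)"
    "\<bar>x 2 - y 2\<bar> \<le> dist (state_vector x) (state_vector y)" "\<bar>x 3 - y 3\<bar> \<le> dist (state_vector x) (state_vector y)"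
    unfolding state_vector_nth .
  ultimately show ?thesis by (elim disjE) (simp_all only:)
qed

lemma state_on_eq: "state_on J \<phi> s = state_vector (\<lambda>j. nth_deriv_on J j \<phi> s)"
  by (simp add: state_on_def state_vector_def)

lemma orbit_cycle: "orbit (readout 0 \<circ> cycle) = range (\<lambda>s. state_vector (\<lambda>j. readout j (cycle s)))"
  using nth_deriv_cycle[of 1] nth_deriv_cycle[of 2] nth_deriv_cycle[of 3]
  unfolding orbit_def state_on_def state_vector_def by simp

lemma infdist_orbit_le:
  assumes near: "near_orbit (mode x) e"
  shows "infdist (state_vector x) (orbit (readout 0 \<circ> cycle)) \<le> 1200 * e"
proof -
  obtain \<sigma> where \<sigma>: "\<sigma> \<in> {-1, 1}"
    and "\<exists>z\<in>{q..1}. \<forall>k\<in>{1..4}. \<bar>\<sigma> * mode x k - relay_arc (\<lambda>_. 0) z k\<bar> \<le> e"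
    using near unfolding near_orbit_def by (rule bexE)
  then obtain z where z: "q \<le> z" "z \<le> 1" and b: "\<And>k. k \<in> {1..4} \<Longrightarrow> \<bar>\<sigma> * mode x k - relay_arc (\<lambda>_. 0) z k\<bar> \<le> e"
    by (meson atLeastAtMost_iff)
  define n :: int where "n = (if \<sigma> = 1 then 0 else 1)"
  \<comment> \<open>This is the time at which \<open>cycle\<close> passes the arc parameter
    \<open>z\<close> on the half orbit of sign \<sigma>.\<close>
  define s where "s = of_int n * half_period - ln z"
  have z0: "0 < z" using z q_bounds by simp
  have "- ln z \<le> half_period" unfolding half_period_def using z z0 q_bounds by simp
  moreover have "0 \<le> - ln z" using z z0 by simp
  ultimately have s: "s \<in> cell n" by (simp add: s_def cell_def algebra_simps)
  have sgn: "parity_sign n = \<sigma>" using \<sigma> by (auto simp: n_def parity_sign_def)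
  have "exp (- (s - of_int n * half_period)) = z" using z0 by (simp add: s_def)
  then have c: "cycle s k = \<sigma> * relay_arc (\<lambda>_. 0) z k" if "k \<in> {1..4}" for k
    using cycle_cell[OF s that] sgn by simp
  have "\<bar>mode x k - cycle s k\<bar> \<le> e" if k: "k \<in> {1..4}" for k
  proof -
    have "\<bar>\<sigma> * (\<sigma> * mode x k - relay_arc (\<lambda>_. 0) z k)\<bar> \<le> e" using b[OF k] \<sigma> by (auto simp: abs_mult)
    moreover have "\<sigma> * (\<sigma> * mode x k - relay_arc (\<lambda>_. 0) z k) = mode x k - cycle s k" using c[OF k] \<sigma> by auto
    ultimately show ?thesis by simp
  qed
  then have "\<bar>readout j (mode x) - readout j (cycle s)\<bar> \<le> 300 * e" if "j < 4" for j
    unfolding readout_diff using that by (intro readout_bound) auto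
  then have r: "\<bar>x j - readout j (cycle s)\<bar> \<le> 300 * e" if "j < 4" for j
    using that by (simp add: readout_mode)
  have r4: "\<bar>x 0 - readout 0 (cycle s)\<bar> \<le> 300 * e" "\<bar>x 1 - readout 1 (cycle s)\<bar> \<le> 300 * e"
    "\<bar>x 2 - readout 2 (cycle s)\<bar> \<le> 300 * e" "\<bar>x 3 - readout 3 (cycle s)\<bar> \<le> 300 * e"
    by (rule r; simp)+
  have "dist (state_vector x) (state_vector (\<lambda>j. readout j (cycle s))) \<le> 1200 * e"
    using dist_state_vector_le[of x "\<lambda>j. readout j (cycle s)"] r4 by argo
  then show ?thesis unfolding orbit_cycle by (rule infdist_le2[OF rangeI])
qed

text \<open>The strict inequality supplies an orbit point closer than \<open>e\<close>; 60 = 1 + 9 +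
  26 + 24 is the largest coefficient sum in \<open>mode\<close>.\<close>

lemma near_orbit_of_infdist:
  assumes "infdist (state_vector x) (orbit (readout 0 \<circ> cycle)) < e"
  shows "near_orbit (mode x) (60 * e)"
proof -
  have "\<exists>v\<in>orbit (readout 0 \<circ> cycle). dist (state_vector x) v < e"
  proof (rule ccontr)
    assume "\<not> (\<exists>v\<in>orbit (readout 0 \<circ> cycle). dist (state_vector x) v < e)"
    then have "e \<le> infdist (state_vector x) (orbit (readout 0 \<circ> cycle))"
      unfolding infdist_def orbit_cycle by (auto intro!: cINF_greatest simp: not_less)
    then show False using assms by simp
  qed
  then obtain s where s: "dist (state_vector x) (state_vector (\<lambda>j. readout j (cycle s))) < e"
    unfolding orbit_cycle by blast
  have r: "\<bar>x j - readout j (cycle s)\<bar> \<le> e" if "j < 4" for j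
    using dist_state_vector_ge[OF that, of x "\<lambda>j. readout j (cycle s)"] s by simp
  have r4: "\<bar>x 0 - readout 0 (cycle s)\<bar> \<le> e" "\<bar>x 1 - readout 1 (cycle s)\<bar> \<le> e"
    "\<bar>x 2 - readout 2 (cycle s)\<bar> \<le> e" "\<bar>x 3 - readout 3 (cycle s)\<bar> \<le> e"
    by (rule r; simp)+
  have m: "\<bar>mode x k - cycle s k\<bar> \<le> 60 * e" if k: "k \<in> {1..4}" for k
  proof -
    have "k = 1 \<or> k = 2 \<or> k = 3 \<or> k = 4" using k by auto
    then have "\<bar>mode x k - mode (\<lambda>j. readout j (cycle s)) k\<bar> \<le> 60 * e"
      using r4 by (elim disjE; simp only: mode_simps; argo)
    then show ?thesis using mode_readout[OF k] by simp
  qed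
  define n where "n = \<lfloor>s / half_period\<rfloor>"
  define z where "z = exp (- (s - of_int n * half_period))"
  have sn: "s \<in> cell n" unfolding n_def by (rule floor_cell)
  have "\<bar>parity_sign n * mode x k - relay_arc (\<lambda>_. 0) z k\<bar> \<le> 60 * e" if k: "k \<in> {1..4}" for k
  proof -
    have "parity_sign n * mode x k - relay_arc (\<lambda>_. 0) z k = parity_sign n * (mode x k - cycle s k)"
      unfolding cycle_cell[OF sn k] z_def right_diff_distrib mult.assoc[symmetric] parity_sign_simps by simp
    then show ?thesis using m[OF k] by (simp add: abs_mult parity_sign_simps)
  qed
  moreover have "z \<in> {q..1}" unfolding z_def by (rule cell_phase[OF sn])
  ultimately show ?thesis unfolding near_orbit_def using parity_sign_simps(5)[of n] by blast
qed

theorem theorem1p1: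
  shows "\<exists>\<phi> :: real \<Rightarrow> real. periodic_solution \<phi> \<and> nontrivial \<phi> \<and> asymptotically_stable \<phi>"
proof (intro exI conjI)
  let ?\<phi> = "readout 0 \<circ> cycle"
  show "periodic_solution ?\<phi>"
    unfolding periodic_solution_def using filippov_cycle half_period_pos cycle_periodic
    by (auto intro!: exI[of _ "2 * half_period"])
  have h: "half_period / 2 \<in> cell 0" using half_period_pos by (simp add: cell_def)
  have "q < exp (- (half_period / 2))" "exp (- (half_period / 2)) < 1"
    unfolding exp_half_period[symmetric] using half_period_pos by simp_all
  then have "0 < readout 0 (relay_arc (\<lambda>_. 0) (exp (- (half_period / 2))))"
    by (rule readout_arc_0_pos)
  then have "?\<phi> (half_period / 2) \<noteq> 0"
    using readout_cycle_cell[OF h, of 0] by (simp add: parity_sign_def)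
  then show "nontrivial ?\<phi>" unfolding nontrivial_def by blast
  let ?D = "\<lambda>\<psi> s. infdist (state_on {0..} \<psi> s) (orbit ?\<phi>)"
  define y where "y \<psi> s = mode (\<lambda>j. nth_deriv_on {0..} j \<psi> s)" for \<psi> s
  have traj: "trajectory (y \<psi>)" if "filippov_solution_on {0..} \<psi>" for \<psi>
    using filippov_trajectory[OF that] unfolding y_def .
  have out: "?D \<psi> s \<le> 1200 * e" if "near_orbit (y \<psi> s) e" for \<psi> s e
    using infdist_orbit_le that unfolding y_def state_on_eq by blast
  have in_: "near_orbit (y \<psi> s) (60 * e)" if "?D \<psi> s < e" for \<psi> s e
    using near_orbit_of_infdist that unfolding y_def state_on_eq by blast
  show "asymptotically_stable ?\<phi>"
    unfolding asymptotically_stable_def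
  proof (intro conjI allI impI)
    fix \<epsilon> :: real assume \<epsilon>: "0 < \<epsilon>"
    \<comment> \<open>Passing to modes costs 60, the evolution 10^14 and passing back 1200; the
      product 7.2 * 10^18 is below 10^20. The bound 1/10^18 keeps 60 \<delta> in the range of
      \<open>trajectory_stability\<close>.\<close>
    define \<delta> where "\<delta> = min (1 / 10^18) (\<epsilon> / 10^20)"
    have \<delta>: "0 < \<delta>" "60 * \<delta> \<le> 1 / 10^16" "1200 * (10^14 * (60 * \<delta>)) < \<epsilon>"
      using \<epsilon> by (auto simp: \<delta>_def min_def)
    show "\<exists>\<delta>>0. \<forall>\<psi>. filippov_solution_on {0..} \<psi> \<and> ?D \<psi> 0 < \<delta> \<longrightarrow> (\<forall>s\<ge>0. ?D \<psi> s < \<epsilon>)"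
    proof (intro exI[of _ \<delta>] conjI allI impI)
      fix \<psi> s assume \<psi>: "filippov_solution_on {0..} \<psi> \<and> ?D \<psi> 0 < \<delta>" and s: "0 \<le> (s::real)"
      have "near_orbit (y \<psi> s) (10^14 * (60 * \<delta>))"
        by (rule trajectory_stability(1)[OF traj _ _ in_ s]) (use \<psi> \<delta> in auto)
      then show "?D \<psi> s < \<epsilon>" using out \<delta>(3) by fastforce
    qed (rule \<delta>(1))
  next
    show "\<exists>\<eta>>0. \<forall>\<psi>. filippov_solution_on {0..} \<psi> \<and> ?D \<psi> 0 < \<eta> \<longrightarrow> (?D \<psi> \<longlongrightarrow> 0) at_top"
    proof (intro exI[of _ "1 / 10^18"] conjI allI impI)
      fix \<psi> assume \<psi>: "filippov_solution_on {0..} \<psi> \<and> ?D \<psi> 0 < 1 / 10^18"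
      show "(?D \<psi> \<longlongrightarrow> 0) at_top"
        unfolding tendsto_iff
      proof (intro allI impI)
        fix \<epsilon> :: real assume \<epsilon>: "0 < \<epsilon>"
        have "\<exists>T. \<forall>t\<ge>T. near_orbit (y \<psi> t) (\<epsilon> / 2400)"
          by (rule trajectory_stability(2)[OF traj _ _ in_[where e = "1 / 10^18"]]) (use \<psi> \<epsilon> in auto)
        then obtain T where T: "\<And>t. T \<le> t \<Longrightarrow> near_orbit (y \<psi> t) (\<epsilon> / 2400)" by blast
        have "dist (?D \<psi> t) 0 < \<epsilon>" if "T \<le> t" for t
          using out[OF T[OF that]] infdist_nonneg[of "state_on {0..} \<psi> t" "orbit ?\<phi>"] \<epsilon>
          by (simp add: dist_real_def)
        then show "\<forall>\<^sub>F t in at_top. dist (?D \<psi> t) 0 < \<epsilon>"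
          using eventually_at_top_linorder by blast
      qed
    qed simp
  qed
qed

end
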